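(* There are absolute constants $c_0,c>0$ such that the following holds. For all integers $d,n\ge 1$, all $\gamma,\alpha,\xi\in(0,c_0]$, all $\epsilon\in(0,1)$ and all $\delta\in[0,c/n]$: every $(\epsilon,\delta)$-DP $(\gamma,0.9\gamma)$-robust proper learner in dimension $d$, with accuracy parameter $\alpha$, failure probability $\xi$ and sample complexity $n$, satisfies $$n\ \ge\ c\cdot\min\left\{\frac{\sqrt d}{\gamma},\,d\right\}.$$
   Context: Let $\mathbb{B}^d=\{\mathbf{x}\in\mathbb{R}^d:\|\mathbf{x}\|_2\le 1\}$. For $\mathbf{w}\in\mathbb{R}^d$ the halfspace $h_{\mathbf{w}}:\mathbb{B}^d\to\{\pm1\}$ is $h_{\mathbf{w}}(\mathbf{x})=\operatorname{sgn}(\langle \mathbf{w},\mathbf{x}\rangle)$, with $\operatorname{sgn}(t)=+1$ for $t\ge 0$ and $-1$ for $t<0$. For $\gamma\ge 0$, a hypothesis $h:\mathbb{B}^d\to\{\pm1\}$ and a distribution $\mathcal{D}$ on $\mathbb{B}^d\times\{\pm1\}$, the robust risk is $\mathcal{R}_\gamma(h,\mathcal{D})=\Pr_{(\mathbf{x},y)\sim\mathcal{D}}[\exists \mathbf{z}\in\mathbb{B}^d:\ \|\mathbf{z}-\mathbf{x}\|_2\le\gamma,\ h(\mathbf{z})\ne y]$. $\mathcal{D}$ is $\gamma$-realizable if there is $\mathbf{w}^*\in\mathbb{R}^d$ with $\mathcal{R}_\gamma(h_{\mathbf{w}^*},\mathcal{D})=0$. A learner is a randomized algorithm $\mathbb{A}$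 that takes a finite dataset (of any size) of labelled points in $\mathbb{B}^d\times\{\pm1\}$ and outputs a hypothesis $h:\mathbb{B}^d\to\{\pm1\}$. It is a $(\gamma,\gamma')$-robust learner with accuracy $\alpha$, failure probability $\xi$ and sample complexity $n$ if, for every $\gamma$-realizable $\mathcal{D}$, when run on $n$ i.i.d. samples from $\mathcal{D}$ it outputs, with probability at least $1-\xi$, a hypothesis $h$ with $\mathcal{R}_{\gamma'}(h,\mathcal{D})\le\alpha$. It is proper if its output is always a halfspace $h_{\mathbf{w}}$, $\mathbf{w}\in\mathbb{R}^d$. Relevant events are assumed measurable. Two datasets are neighbors if one results from the other by adding or removing a single data point. A randomized algorithm $\mathbb{A}$ is $(\epsilon,\delta)$-DP if for all neighboring datasets $\mathbf{X},\mathbf{X}'$ and all sets $S$ of outputs, $\Pr[\mathbb{A}(\mathbf{X})\in S]\le e^{\epsilon}\Pr[\mathbb{A}(\mathbf{X}')\in S]+\delta$. *)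

theory Defs
  imports "HOL-Probability.Probability"
begin

text \<open>The dimension is quantified inside the statement, so points of $\mathbb{R}^d$ are
  extensional functions on \<open>{..<d}\<close>, measured by the product Borel algebra.\<close>

abbreviation Rd :: "nat \<Rightarrow> (nat \<Rightarrow> real) set" where
  "Rd d \<equiv> {..<d} \<rightarrow>\<^sub>E UNIV"

definition unit_ball :: "nat \<Rightarrow> (nat \<Rightarrow> real) set" where
  "unit_ball d = {x \<in> Rd d. L2_set x {..<d} \<le> 1}"

definition example_space :: "nat \<Rightarrow> ((nat \<Rightarrow> real) \<times> int) measure" where
  "example_space d =
     restrict_space (Pi\<^sub>M {..<d} (\<lambda>_. borel)) (unit_ball d) \<Otimes>\<^sub>M count_space {-1, 1}"

abbreviation hypotheses :: "nat \<Rightarrow> ((nat \<Rightarrow> real) \<Rightarrow> int) set" where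
  "hypotheses d \<equiv> unit_ball d \<rightarrow>\<^sub>E {-1, 1}"

text \<open>The library's \<^const>\<open>sgn\<close> vanishes at \<open>0\<close>; here the sign of \<open>0\<close> is \<open>+1\<close>.\<close>

definition halfspace :: "nat \<Rightarrow> (nat \<Rightarrow> real) \<Rightarrow> (nat \<Rightarrow> real) \<Rightarrow> int" where
  "halfspace d w = (\<lambda>x\<in>unit_ball d. if (\<Sum>i<d. w i * x i) \<ge> 0 then 1 else -1)"

definition robust_error :: "nat \<Rightarrow> real \<Rightarrow> ((nat \<Rightarrow> real) \<Rightarrow> int) \<Rightarrow> ((nat \<Rightarrow> real) \<times> int) set" where
  "robust_error d \<gamma> h = {(x, y) \<in> space (example_space d).
     \<exists>z\<in>unit_ball d. L2_set (\<lambda>i. z i - x i) {..<d} \<le> \<gamma> \<and> h z \<noteq> y}"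

text \<open>Meaningful only if \<^const>\<open>robust_error\<close> is measurable. This holds for halfspaces
  (the sets involved are countable unions of compact sets), and
  \<open>robust_learner\<close> below demands it for all outputs of a learner.\<close>

definition robust_risk ::
  "nat \<Rightarrow> real \<Rightarrow> ((nat \<Rightarrow> real) \<Rightarrow> int) \<Rightarrow> ((nat \<Rightarrow> real) \<times> int) measure \<Rightarrow> real" where
  "robust_risk d \<gamma> h D = measure D (robust_error d \<gamma> h)"

definition realizable :: "nat \<Rightarrow> real \<Rightarrow> ((nat \<Rightarrow> real) \<times> int) measure \<Rightarrow> bool" where
  "realizable d \<gamma> D \<longleftrightarrow> (\<exists>w\<in>Rd d. robust_risk d \<gamma> (halfspace d w) D = 0)"

text \<open>A dataset is a list of examples. Adding or removing a point may happen at any position;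
  learners on multisets are the special case of learners ignoring the order.\<close>

abbreviation datasets :: "nat \<Rightarrow> ((nat \<Rightarrow> real) \<times> int) list set" where
  "datasets d \<equiv> lists (space (example_space d))"

definition neighbors :: "'a list \<Rightarrow> 'a list \<Rightarrow> bool" where
  "neighbors X X' \<longleftrightarrow> (\<exists>us z vs.
     (X = us @ vs \<and> X' = us @ z # vs) \<or> (X = us @ z # vs \<and> X' = us @ vs))"

text \<open>A randomized learner maps each dataset to a probability distribution over its possible
  outputs. There is no canonical \<open>\<sigma>\<close>-algebra on arbitrary hypotheses, so the learner comes with
  one: \<open>space M\<close> is its set of possible outputs and \<open>sets M\<close> are the events. It is only required
  that the prediction at each fixed point be a random variable.\<close>

definition randomized_learner ::
  "nat \<Rightarrow> ((nat \<Rightarrow> real) \<Rightarrow> int) measure \<Rightarrow>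
   (((nat \<Rightarrow> real) \<times> int) list \<Rightarrow> ((nat \<Rightarrow> real) \<Rightarrow> int) measure) \<Rightarrow> bool" where
  "randomized_learner d M A \<longleftrightarrow>
     space M \<subseteq> hypotheses d \<and>
     (\<forall>x\<in>unit_ball d. (\<lambda>h. h x) \<in> M \<rightarrow>\<^sub>M count_space {-1, 1}) \<and>
     (\<forall>X\<in>datasets d. A X \<in> space (prob_algebra M))"

definition proper :: "nat \<Rightarrow> ((nat \<Rightarrow> real) \<Rightarrow> int) measure \<Rightarrow> bool" where
  "proper d M \<longleftrightarrow> space M \<subseteq> halfspace d ` Rd d"

definition differentially_private ::
  "real \<Rightarrow> real \<Rightarrow> nat \<Rightarrow> ((nat \<Rightarrow> real) \<Rightarrow> int) measure \<Rightarrow>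
   (((nat \<Rightarrow> real) \<times> int) list \<Rightarrow> ((nat \<Rightarrow> real) \<Rightarrow> int) measure) \<Rightarrow> bool" where
  "differentially_private \<epsilon> \<delta> d M A \<longleftrightarrow>
     (\<forall>X\<in>datasets d. \<forall>X'\<in>datasets d. neighbors X X' \<longrightarrow>
        (\<forall>S\<in>sets M. measure (A X) S \<le> exp \<epsilon> * measure (A X') S + \<delta>))"

definition output_distribution ::
  "nat \<Rightarrow> ((nat \<Rightarrow> real) \<times> int) measure \<Rightarrow>
   (((nat \<Rightarrow> real) \<times> int) list \<Rightarrow> ((nat \<Rightarrow> real) \<Rightarrow> int) measure) \<Rightarrow>
   ((nat \<Rightarrow> real) \<Rightarrow> int) measure" where
  "output_distribution n D A = Pi\<^sub>M {..<n} (\<lambda>_. D) \<bind> (\<lambda>s. A (map s [0..<n]))"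

text \<open>The second and third conjuncts and the membership in \<open>sets M\<close> express that the events
  in the definition are measurable.\<close>

definition robust_learner ::
  "nat \<Rightarrow> real \<Rightarrow> real \<Rightarrow> real \<Rightarrow> real \<Rightarrow> nat \<Rightarrow> ((nat \<Rightarrow> real) \<Rightarrow> int) measure \<Rightarrow>
   (((nat \<Rightarrow> real) \<times> int) list \<Rightarrow> ((nat \<Rightarrow> real) \<Rightarrow> int) measure) \<Rightarrow> bool" where
  "robust_learner d \<gamma> \<gamma>' \<alpha> \<xi> n M A \<longleftrightarrow>
     randomized_learner d M A \<and>
     (\<lambda>s. A (map s [0..<n])) \<in> Pi\<^sub>M {..<n} (\<lambda>_. example_space d) \<rightarrow>\<^sub>M prob_algebra M \<and>
     (\<forall>h\<in>space M. robust_error d \<gamma>' h \<in> sets (example_space d)) \<and>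
     (\<forall>D\<in>space (prob_algebra (example_space d)). realizable d \<gamma> D \<longrightarrow>
        {h \<in> space M. robust_risk d \<gamma>' h D \<le> \<alpha>} \<in> sets M \<and>
        measure (output_distribution n D A) {h \<in> space M. robust_risk d \<gamma>' h D \<le> \<alpha>} \<ge> 1 - \<xi>)"

end

theory Submission
  imports Defs
begin

text \<open>The argument is a fingerprinting attack whose unknown parameter ranges over a torus. For angles
  \<open>\<theta>\<^sub>1, \<dots>, \<theta>\<^sub>K\<close> with \<open>K \<approx> d / 2\<close>, consider sign vectors in \<open>{1 + i, 1 - i, -1 + i, -1 - i}\<^sup>K\<close> whose
  independent entries are biased by \<open>b\<close> towards \<open>cis \<theta>\<^sub>k\<close>, where \<open>b\<close> is of the order of \<open>max \<gamma> (1 / sqrt K)\<close>.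
  A smooth cutoff moves the mass of sign vectors without margin to one extra example; afterwards
  the distribution is \<open>\<gamma>\<close>-realizable by the vector \<open>p = (cis \<theta>\<^sub>k)\<^sub>k\<close>, which has norm \<open>sqrt K\<close> for all \<open>\<theta>\<close>.
  An accurate learner must output a unit vector \<open>v\<close> with \<open>v \<bullet> p \<ge> sqrt K / 20\<close> in expectation.

  Let \<open>H\<^sub>k(\<theta>)\<close> be the expectation of the component of \<open>v\<^sub>k\<close> along the tangent vector \<open>i cis \<theta>\<^sub>k\<close>. The
  divergence of the periodic field \<open>H\<close> has mean zero. Differentiating the tangent vectors contributes
  the expectation of \<open>- v \<bullet> p\<close>. Differentiating the distribution of the sample
  contributes, for each of the \<open>n\<close> examples, the covariance of \<open>v\<close> with a centred score of that
  example. For a fixed unit vector the score has absolute mean \<open>O(b)\<close>, and by privacy the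
  dependence of \<open>v\<close> on the example costs only a constant factor and a term in \<open>\<delta>\<close>. Hence
  \<open>sqrt K \<le> O(n b)\<close>. All labels are \<open>-1\<close>, which rules out the constant hypothesis given by \<open>w = 0\<close>.\<close>

section \<open>Sums over product sets\<close>

lemma sum_PiE_insert:
  assumes "i \<notin> I"
  shows "(\<Sum>x\<in>PiE (insert i I) B. f x) = (\<Sum>y\<in>B i. \<Sum>x\<in>PiE I B. f (x(i := y)))"
proof -
  have "(\<Sum>x\<in>PiE (insert i I) B. f x) = (\<Sum>(y, x)\<in>B i \<times> PiE I B. f (x(i := y)))"
    unfolding PiE_insert_eq
    by (subst sum.reindex) (use assms in \<open>auto simp: case_prod_unfold inj_combinator[unfolded case_prod_unfold]\<close>)
  then show ?thesis
    by (simp add: sum.cartesian_product)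
qed

text \<open>The variance of a sum of independent centred terms: when a factor is added, the cross
  term contains the mean of \<open>g i\<close> and vanishes.\<close>

lemma sum_PiE_second_moment:
  fixes q g :: "'i \<Rightarrow> 'v \<Rightarrow> real"
  assumes "finite I" "\<And>i. i \<in> I \<Longrightarrow> finite (B i)"
    and "\<And>i. i \<in> I \<Longrightarrow> (\<Sum>v\<in>B i. q i v) = 1"
    and "\<And>i. i \<in> I \<Longrightarrow> (\<Sum>v\<in>B i. q i v * g i v) = 0"
  shows "(\<Sum>x\<in>PiE I B. (\<Prod>i\<in>I. q i (x i)) * (\<Sum>i\<in>I. g i (x i))\<^sup>2) =
    (\<Sum>i\<in>I. \<Sum>v\<in>B i. q i v * (g i v)\<^sup>2)"
  using assms
proof (induction I rule: finite_induct)
  case (insert i I)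
  let ?P = "\<lambda>x. \<Prod>j\<in>I. q j (x j)" and ?S = "\<lambda>x. \<Sum>j\<in>I. g j (x j)"
  have one: "(\<Sum>x\<in>PiE I B. ?P x) = 1"
    using insert.prems insert.hyps by (subst prod_sum_PiE[symmetric]) auto
  have upd: "(\<Prod>j\<in>insert i I. q j ((x(i := y)) j)) = q i y * ?P x"
    "(\<Sum>j\<in>insert i I. g j ((x(i := y)) j)) = g i y + ?S x" for x y
    using insert.hyps by (auto intro!: prod.cong sum.cong)
  have "(\<Sum>x\<in>PiE (insert i I) B. (\<Prod>j\<in>insert i I. q j (x j)) * (\<Sum>j\<in>insert i I. g j (x j))\<^sup>2) =
    (\<Sum>y\<in>B i. \<Sum>x\<in>PiE I B. (q i y * ?P x) * (g i y + ?S x)\<^sup>2)"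
    by (subst sum_PiE_insert[OF insert.hyps(2)]) (simp only: upd)
  also have "\<dots> = (\<Sum>y\<in>B i. \<Sum>x\<in>PiE I B. (q i y * (g i y)\<^sup>2) * ?P x +
      ((q i y * g i y) * (2 * ?P x * ?S x) + q i y * (?P x * (?S x)\<^sup>2)))"
    by (intro sum.cong refl) (simp add: power2_eq_square algebra_simps)
  also have "\<dots> = (\<Sum>y\<in>B i. q i y * (g i y)\<^sup>2) * (\<Sum>x\<in>PiE I B. ?P x) +
      ((\<Sum>y\<in>B i. q i y * g i y) * (\<Sum>x\<in>PiE I B. 2 * ?P x * ?S x) +
       (\<Sum>y\<in>B i. q i y) * (\<Sum>x\<in>PiE I B. ?P x * (?S x)\<^sup>2))"
    by (simp only: sum.distrib sum_product)
  also have "\<dots> = (\<Sum>y\<in>B i. q i y * (g i y)\<^sup>2) + (\<Sum>i\<in>I. \<Sum>v\<in>B i. q i v * (g i v)\<^sup>2)"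
    using insert by (simp add: one)
  finally show ?case
    using insert.hyps by simp
qed simp

text \<open>Bounds a first absolute moment by the root of a second moment, through a pointwise
  arithmetic-geometric mean inequality.\<close>

lemma weighted_sum_abs_le:
  fixes w f :: "'a \<Rightarrow> real"
  assumes "\<And>x. x \<in> A \<Longrightarrow> w x \<ge> 0" "(\<Sum>x\<in>A. w x) \<le> 1"
    and "(\<Sum>x\<in>A. w x * (f x)\<^sup>2) \<le> s\<^sup>2" "s > 0"
  shows "(\<Sum>x\<in>A. w x * \<bar>f x\<bar>) \<le> s"
proof -
  have amgm: "\<bar>y\<bar> \<le> (y\<^sup>2 / s + s) / 2" for y :: real
  proof -
    have "0 \<le> (\<bar>y\<bar> - s)\<^sup>2 / s" using assms(4) by simp
    also have "\<dots> = y\<^sup>2 / s + s - 2 * \<bar>y\<bar>"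
      using assms(4) by (simp add: power2_eq_square field_simps)
    finally show ?thesis by simp
  qed
  have "(\<Sum>x\<in>A. w x * \<bar>f x\<bar>) \<le> (\<Sum>x\<in>A. w x * (((f x)\<^sup>2 / s + s) / 2))"
    by (intro sum_mono mult_left_mono amgm assms(1))
  also have "\<dots> = ((\<Sum>x\<in>A. w x * (f x)\<^sup>2) / s + s * (\<Sum>x\<in>A. w x)) / 2"
    by (simp add: sum.distrib sum_divide_distrib sum_distrib_left distrib_left add_divide_distrib mult_ac)
  also have "\<dots> \<le> (s\<^sup>2 / s + s * 1) / 2"
    using assms by (intro divide_right_mono add_mono mult_left_mono) auto
  finally show ?thesis using assms(4) by (simp add: power2_eq_square)
qed

lemma weighted_sum_Chebyshev:
  fixes w f :: "'a \<Rightarrow> real"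
  assumes "finite A" "\<And>x. x \<in> A \<Longrightarrow> w x \<ge> 0" "(\<Sum>x\<in>A. w x * (f x)\<^sup>2) \<le> v" "s > 0"
  shows "(\<Sum>x\<in>{x\<in>A. \<bar>f x\<bar> \<ge> s}. w x) \<le> v / s\<^sup>2"
proof -
  have "s\<^sup>2 * (\<Sum>x\<in>{x\<in>A. \<bar>f x\<bar> \<ge> s}. w x) = (\<Sum>x\<in>{x\<in>A. \<bar>f x\<bar> \<ge> s}. w x * s\<^sup>2)"
    by (simp add: sum_distrib_left mult_ac)
  also have "\<dots> \<le> (\<Sum>x\<in>{x\<in>A. \<bar>f x\<bar> \<ge> s}. w x * (f x)\<^sup>2)"
    using assms by (intro sum_mono mult_left_mono) (auto simp: abs_le_square_iff[symmetric])
  also have "\<dots> \<le> (\<Sum>x\<in>A. w x * (f x)\<^sup>2)"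
    using assms by (intro sum_mono2) auto
  finally show ?thesis using assms by (simp add: field_simps)
qed

lemma sum_lessThan_double: "(\<Sum>j<2 * K. f j) = (\<Sum>k<K. f (2 * k) + f (2 * k + 1))" for f :: "nat \<Rightarrow> real"
  by (induction K) (simp_all add: add_ac)

text \<open>Exposes one entry of a sample in the form \<open>us @ z # vs\<close>, in which
  \<open>neighbors\<close> adds or removes a point.\<close>

lemma map_upt_update:
  assumes "i < n"
  shows "map (X(i := y)) [0..<n] = map X [0..<i] @ y # map X [Suc i..<n]"
proof -
  have "[0..<n] = [0..<i] @ i # [Suc i..<n]"
    using assms upt_add_eq_append[of 0 i "n - i"] by (simp add: upt_conv_Cons)
  then show ?thesis by simp
qed

section \<open>A smooth cutoff\<close>

text \<open>The step \<open>1 - (1 - s^2)^2\<close> from 0 at \<open>s = 0\<close> to 1 at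
  \<open>s = 1\<close>, extended by constants. The squared positive parts make it continuously
  differentiable, and the divergence argument differentiates only once.\<close>

definition cutoff :: "real \<Rightarrow> real" where
  "cutoff s = 1 - (max 0 (1 - (max 0 s)\<^sup>2))\<^sup>2"

definition cutoff' :: "real \<Rightarrow> real" where
  "cutoff' s = 4 * max 0 (1 - (max 0 s)\<^sup>2) * max 0 s"

lemma DERIV_max_0_square: "((\<lambda>s. (max 0 s)\<^sup>2) has_real_derivative 2 * max 0 s) (at s)" for s :: real
proof (cases s "0 :: real" rule: linorder_cases)
  case less
  have "((\<lambda>_. 0) has_real_derivative 2 * max 0 s) (at s)"
    using less by (auto intro!: derivative_eq_intros)
  then show ?thesis
    by (rule DERIV_cong_ev[THEN iffD1, rotated -1])
      (use less in \<open>auto intro!: eventually_mono[OF eventually_nhds_in_open[of "{..<0}" s]]\<close>)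
next
  case greater
  have "((\<lambda>s. s\<^sup>2) has_real_derivative 2 * max 0 s) (at s)"
    using greater by (auto intro!: derivative_eq_intros)
  then show ?thesis
    by (rule DERIV_cong_ev[THEN iffD1, rotated -1])
      (use greater in \<open>auto intro!: eventually_mono[OF eventually_nhds_in_open[of "{0<..}" s]]\<close>)
next
  case equal
  \<comment> \<open>At the kink the difference quotient is bounded by the absolute value of
    \<open>h\<close>.\<close>
  have "((\<lambda>h. (max 0 h)\<^sup>2 / h) \<longlongrightarrow> 0) (at (0::real))"
  proof (rule Lim_null_comparison)
    show "\<forall>\<^sub>F h in at 0. norm ((max 0 h)\<^sup>2 / h) \<le> \<bar>h\<bar>" for h :: real
      by (intro always_eventually) (auto simp: max_def power2_eq_square)
    show "(abs \<longlongrightarrow> 0) (at (0::real))"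
      by (rule tendsto_rabs_zero) simp
  qed
  then show ?thesis
    using equal by (simp add: DERIV_def)
qed

lemma DERIV_cutoff: "(cutoff has_real_derivative cutoff' s) (at s)"
proof -
  note [derivative_intros] = DERIV_chain2[OF DERIV_max_0_square]
  show ?thesis
    unfolding cutoff_def[abs_def] cutoff'_def by (auto intro!: derivative_eq_intros)
qed

lemma cutoff_nonneg: "cutoff s \<ge> 0"
  and cutoff_le_1: "cutoff s \<le> 1"
  and cutoff_eq_1: "s \<ge> 1 \<Longrightarrow> cutoff s = 1"
  by (auto simp: cutoff_def power_le_one max_def abs_square_le_1 split: if_splits)

lemma cutoff_pos_imp: "cutoff s > 0 \<Longrightarrow> s > 0"
  by (rule ccontr) (simp add: cutoff_def max_absorb1 not_less)

lemma abs_cutoff'_le: "\<bar>cutoff' s\<bar> \<le> 4"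
proof -
  have "0 \<le> max 0 (1 - (max 0 s)\<^sup>2) * max 0 s" by simp
  moreover have "max 0 (1 - (max 0 s)\<^sup>2) * max 0 s \<le> 1"
  proof (cases "0 \<le> s \<and> s \<le> 1")
    case True
    then have "(1 - s\<^sup>2) * s \<le> 1 * 1" by (intro mult_mono) auto
    then show ?thesis using True by (auto simp: max_def power_le_one)
  next
    case False
    then have "s < 0 \<or> s\<^sup>2 > 1" by (auto simp: one_less_power)
    then show ?thesis by (auto simp: max_def)
  qed
  ultimately show ?thesis by (simp add: cutoff'_def)
qed

lemma cutoff_measurable [measurable]: "cutoff \<in> borel_measurable borel"
  and cutoff'_measurable [measurable]: "cutoff' \<in> borel_measurable borel"
  unfolding cutoff_def[abs_def] cutoff'_def[abs_def] by measurable

section \<open>Privacy and expectations\<close>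

text \<open>Layer-cake argument: discretise the levels of \<open>f\<close> and apply the hypothesis to the
  superlevel sets.\<close>

lemma integral_le_of_measure_le:
  fixes f :: "'a \<Rightarrow> real"
  assumes "prob_space M" "prob_space N" "sets M = sets P" "sets N = sets P"
    and le: "\<And>S. S \<in> sets P \<Longrightarrow> measure M S \<le> a * measure N S + \<delta>"
    and f: "f \<in> borel_measurable P" "\<And>x. 0 \<le> f x" "\<And>x. f x \<le> B"
    and nonneg: "a \<ge> 0" "\<delta> \<ge> 0"
  shows "(\<integral>x. f x \<partial>M) \<le> a * (\<integral>x. f x \<partial>N) + \<delta> * B"
proof (cases "B > 0")
  case False
  then have "f x = 0" for x using f(2,3)[of x] by simp
  moreover have "B = 0" using False f(2,3) by (meson leI order.antisym order_trans)
  ultimately show ?thesis by simp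
next
  case B: True
  interpret M: prob_space M by fact
  interpret N: prob_space N by fact
  have [measurable]: "f \<in> borel_measurable M" "f \<in> borel_measurable N"
    using f(1) assms(3,4) by (simp_all cong: measurable_cong_sets)
  have spaces: "space M = space P" "space N = space P"
    using assms(3,4) by (auto dest: sets_eq_imp_space_eq)
  have int: "integrable M f" "integrable N f"
    using f(2,3) by (auto intro!: M.integrable_const_bound[of _ B] N.integrable_const_bound[of _ B])
  have step: "(\<integral>x. f x \<partial>M) \<le> a * (\<integral>x. f x \<partial>N) + \<delta> * B + B / n" if n: "n > 0" for n :: nat
  proof -
    define u where "u = B / n"
    have u: "u > 0" using B n by (simp add: u_def)
    define L where "L k = {x \<in> space P. f x \<ge> u * real k}" for k
    have L: "L k \<in> sets P" for k unfolding L_def using f(1) by measurable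
    define s where "s x = (\<Sum>k\<in>{1..n}. u * indicator (L k) x)" for x
    have s: "s x \<le> f x \<and> f x \<le> s x + u" if x: "x \<in> space P" for x
    proof -
      define m where "m = nat \<lfloor>f x / u\<rfloor>"
      have m0: "real m = of_int \<lfloor>f x / u\<rfloor>" using f(2)[of x] u by (simp add: m_def)
      have m: "real m \<le> f x / u" "f x / u < real m + 1" unfolding m0 by linarith+
      have iff: "f x \<ge> u * real k \<longleftrightarrow> k \<le> m" for k
      proof
        assume "f x \<ge> u * real k"
        then have "real k \<le> f x / u" using u by (simp add: field_simps)
        then show "k \<le> m" using m(2) by linarith
      next
        assume "k \<le> m"
        then have "real k \<le> f x / u" using m(1) by linarith
        then show "f x \<ge> u * real k" using u by (simp add: field_simps)
      qed
      have "f x / u \<le> n" using f(3)[of x] u B n by (simp add: u_def field_simps)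
      then have "m \<le> n" using m(1) by linarith
      have "s x = (\<Sum>k\<in>{1..n}. if k \<le> m then u else 0)"
        unfolding s_def L_def using x iff by (intro sum.cong) (auto simp: indicator_def)
      also have "\<dots> = (\<Sum>k\<in>{1..m}. u)"
        using \<open>m \<le> n\<close> by (intro sum.mono_neutral_cong_right) auto
      finally have "s x = u * real m" by simp
      then show ?thesis using m u by (simp add: field_simps)
    qed
    have ints: "integrable M s" "integrable N s"
      "(\<integral>x. s x \<partial>M) = (\<Sum>k\<in>{1..n}. u * measure M (L k))"
      "(\<integral>x. s x \<partial>N) = (\<Sum>k\<in>{1..n}. u * measure N (L k))"
    proof -
      have "has_bochner_integral M s (\<Sum>k\<in>{1..n}. u * measure M (L k))"
        unfolding s_def using L assms(3)
        by (intro has_bochner_integral_sum has_bochner_integral_mult_right has_bochner_integral_real_indicator)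
          (auto simp: M.emeasure_eq_measure)
      moreover have "has_bochner_integral N s (\<Sum>k\<in>{1..n}. u * measure N (L k))"
        unfolding s_def using L assms(4)
        by (intro has_bochner_integral_sum has_bochner_integral_mult_right has_bochner_integral_real_indicator)
          (auto simp: N.emeasure_eq_measure)
      ultimately show "integrable M s" "integrable N s"
        "(\<integral>x. s x \<partial>M) = (\<Sum>k\<in>{1..n}. u * measure M (L k))"
        "(\<integral>x. s x \<partial>N) = (\<Sum>k\<in>{1..n}. u * measure N (L k))"
        by (auto simp: has_bochner_integral_iff)
    qed
    have "(\<integral>x. f x \<partial>M) \<le> (\<integral>x. s x + u \<partial>M)"
      using s spaces ints int by (intro integral_mono) auto
    also have "\<dots> = (\<Sum>k\<in>{1..n}. u * measure M (L k)) + u"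
      using ints by (simp add: M.prob_space)
    \<comment> \<open>The hypothesis is applied at \<open>n\<close> levels of height
      \<open>B / n\<close>, so the additive errors add up to \<open>\<delta> * B\<close> for every
      \<open>n\<close>.\<close>
    also have "\<dots> \<le> (\<Sum>k\<in>{1..n}. u * (a * measure N (L k) + \<delta>)) + u"
      using u L le by (intro add_mono sum_mono mult_left_mono) auto
    also have "\<dots> = a * (\<integral>x. s x \<partial>N) + \<delta> * B + u"
      using n by (simp add: ints sum.distrib sum_distrib_left distrib_left u_def mult_ac)
    also have "\<dots> \<le> a * (\<integral>x. f x \<partial>N) + \<delta> * B + u"
      using s spaces ints int nonneg by (intro add_mono mult_left_mono integral_mono) auto
    finally show ?thesis by (simp add: u_def)
  qed
  have lim: "(\<lambda>n. a * (\<integral>x. f x \<partial>N) + \<delta> * B + B / real n) \<longlonglongrightarrow> a * (\<integral>x. f x \<partial>N) + \<delta> * B + 0"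
    by (intro tendsto_intros lim_const_over_n)
  have "(\<integral>x. f x \<partial>M) \<le> a * (\<integral>x. f x \<partial>N) + \<delta> * B + 0"
    by (rule tendsto_lowerbound[OF lim]) (use step in \<open>auto intro!: eventually_mono[OF eventually_gt_at_top[of 0]]\<close>)
  then show ?thesis by simp
qed

text \<open>Only the positive part of \<open>f\<close> is transported, with the factor
  \<open>exp \<epsilon> <= 3\<close>; for the parts \<open>p\<close> and \<open>m\<close> of
  \<open>f\<close>, \<open>3 * p <= (p - m) + 2 * (p + m)\<close>. The signed integral is kept on
  the right because it cancels later, when such bounds are summed over the possible values of one
  example.\<close>

lemma integral_diff_le_of_private:
  fixes f :: "'a \<Rightarrow> real"
  assumes MN: "prob_space M" "prob_space N" "sets M = sets P" "sets N = sets P"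
    and le: "\<And>S. S \<in> sets P \<Longrightarrow> measure M S \<le> exp \<epsilon> * measure N S + \<delta>"
    and f: "f \<in> borel_measurable P" "\<And>x. \<bar>f x\<bar> \<le> B"
    and nonneg: "\<epsilon> \<le> 1" "\<delta> \<ge> 0"
  shows "(\<integral>x. f x \<partial>M) \<le> (\<integral>x. f x \<partial>N) + 2 * (\<integral>x. \<bar>f x\<bar> \<partial>N) + \<delta> * B"
proof -
  interpret M: prob_space M by fact
  interpret N: prob_space N by fact
  have [measurable]: "f \<in> borel_measurable M" "f \<in> borel_measurable N" "f \<in> borel_measurable P"
    using f(1) assms(3,4) by (simp_all cong: measurable_cong_sets)
  let ?p = "\<lambda>x. max 0 (f x)" and ?m = "\<lambda>x. max 0 (- f x)"
  have B: "0 \<le> B" using f(2)[of undefined] by linarith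
  have b: "?p x \<le> B" "?m x \<le> B" for x using f(2)[of x] B by (auto simp: abs_le_iff)
  have int: "integrable M ?p" "integrable N ?p" "integrable N ?m" "integrable M f"
    using b B f(2) by (auto intro!: M.integrable_const_bound[of _ B] N.integrable_const_bound[of _ B])
  have "(\<integral>x. f x \<partial>N) = (\<integral>x. ?p x - ?m x \<partial>N)"
    by (intro Bochner_Integration.integral_cong) auto
  then have fN: "(\<integral>x. f x \<partial>N) = (\<integral>x. ?p x \<partial>N) - (\<integral>x. ?m x \<partial>N)"
    using int by simp
  have "(\<integral>x. \<bar>f x\<bar> \<partial>N) = (\<integral>x. ?p x + ?m x \<partial>N)"
    by (intro Bochner_Integration.integral_cong) auto
  then have aN: "(\<integral>x. \<bar>f x\<bar> \<partial>N) = (\<integral>x. ?p x \<partial>N) + (\<integral>x. ?m x \<partial>N)"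
    using int by simp
  have pos: "0 \<le> (\<integral>x. ?p x \<partial>N)" "0 \<le> (\<integral>x. ?m x \<partial>N)" by simp_all
  have e3: "exp \<epsilon> \<le> 3" using exp_le nonneg(1) by (meson exp_le_cancel_iff order_trans)
  have "(\<integral>x. f x \<partial>M) \<le> (\<integral>x. ?p x \<partial>M)" using int by (intro integral_mono) auto
  also have "\<dots> \<le> exp \<epsilon> * (\<integral>x. ?p x \<partial>N) + \<delta> * B"
    by (rule integral_le_of_measure_le[OF MN le]) (use b nonneg in auto)
  also have "exp \<epsilon> * (\<integral>x. ?p x \<partial>N) \<le> 3 * (\<integral>x. ?p x \<partial>N)"
    using e3 pos by (intro mult_right_mono)
  finally have "(\<integral>x. f x \<partial>M) \<le> 3 * (\<integral>x. ?p x \<partial>N) + \<delta> * B" by simp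
  moreover have "x \<le> p - m + 2 * (p + m) + d" if "x \<le> 3 * p + d" "0 \<le> m" for x p m d :: real
    using that by simp
  ultimately show ?thesis using pos(2) unfolding fN aN by blast
qed

section \<open>The divergence theorem on the torus\<close>

lemma integral_uniform_interval_FTC:
  fixes f f' :: "real \<Rightarrow> real"
  assumes "a < b"
    and deriv: "\<And>t. (f has_real_derivative f' t) (at t)"
    and f': "f' \<in> borel_measurable borel" "\<And>t. \<bar>f' t\<bar> \<le> B"
  shows "(\<integral>t. f' t \<partial>uniform_measure lborel {a..b}) = (f b - f a) / (b - a)"
proof -
  have int: "set_integrable lborel {a..b} f'"
    unfolding set_integrable_def
  proof (rule Bochner_Integration.integrable_bound)
    show "integrable lborel (\<lambda>t. B * indicator {a..b} t :: real)"
      using assms(1) by (intro integrable_mult_right) (auto simp: integrable_indicator_iff)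
    show "AE x in lborel. norm (indicat_real {a..b} x *\<^sub>R f' x) \<le> norm (B * indicat_real {a..b} x)"
      using f'(2) by (intro AE_I2) (auto simp: indicator_def intro: order_trans[OF _ abs_ge_self])
  qed (use f'(1) in measurable)
  \<comment> \<open>The gauge integral allows a discontinuous derivative; boundedness and
    measurability then identify it with the Lebesgue integral.\<close>
  have "(f' has_integral (f b - f a)) {a..b}"
    using assms(1) deriv by (intro fundamental_theorem_of_calculus)
      (auto simp: has_real_derivative_iff_has_vector_derivative[symmetric] intro: DERIV_subset)
  then have "(\<integral>t. indicator {a..b} t * f' t \<partial>lborel) = f b - f a"
    using set_borel_integral_eq_integral(2)[OF int]
    by (simp add: set_lebesgue_integral_def integral_unique)
  moreover have "(\<integral>t. f' t \<partial>uniform_measure lborel {a..b}) =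
      (\<integral>t. (indicator {a..b} t / (b - a)) * f' t \<partial>lborel)"
  proof -
    have "uniform_measure lborel {a..b} = density lborel (\<lambda>t. ennreal (indicator {a..b} t / (b - a)))"
      using assms(1) unfolding uniform_measure_def
      by (intro density_cong AE_I2) (auto simp: indicator_def divide_ennreal ennreal_1[symmetric] simp del: ennreal_1)
    then show ?thesis
      using f'(1) assms(1) by (simp add: integral_density)
  qed
  ultimately show ?thesis
    by (simp add: field_simps)
qed

text \<open>The divergence of a periodic field integrates to zero, so it is not bounded above by \<open>- \<eta>\<close>.\<close>

lemma torus_divergence_not_negative:
  fixes H G :: "'i \<Rightarrow> ('i \<Rightarrow> real) \<Rightarrow> real"
  assumes I: "finite I"
    and deriv: "\<And>k \<theta>. k \<in> I \<Longrightarrow> ((\<lambda>t. H k (\<theta>(k := t))) has_real_derivative G k \<theta>) (at (\<theta> k))"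
    and periodic: "\<And>k \<theta>. k \<in> I \<Longrightarrow> H k (\<theta>(k := 2 * pi)) = H k (\<theta>(k := 0))"
    and meas: "\<And>k. k \<in> I \<Longrightarrow> G k \<in> borel_measurable (Pi\<^sub>M I (\<lambda>_. borel))"
    and bound: "\<And>k \<theta>. k \<in> I \<Longrightarrow> \<bar>G k \<theta>\<bar> \<le> B k"
    and neg: "\<And>\<theta>. (\<Sum>k\<in>I. G k \<theta>) \<le> - \<eta>" and "\<eta> > 0"
  shows False
proof -
  define U where "U = uniform_measure lborel {0..2 * pi}"
  interpret U: prob_space U
    unfolding U_def by (rule prob_space_uniform_measure) auto
  have setsU: "sets U = sets borel" by (simp add: U_def)
  interpret P: product_prob_space "\<lambda>_::'i. U" ..
  have PI: "prob_space (Pi\<^sub>M I (\<lambda>_. U))" by (intro prob_space_PiM U.prob_space_axioms)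
  have sets: "sets (Pi\<^sub>M I (\<lambda>_. U)) = sets (Pi\<^sub>M I (\<lambda>_. borel))"
    by (intro sets_PiM_cong refl) (simp add: setsU)
  have G: "G k \<in> borel_measurable (Pi\<^sub>M I (\<lambda>_. U))" if "k \<in> I" for k
    using meas[OF that] sets by (simp cong: measurable_cong_sets)
  have int: "integrable (Pi\<^sub>M I (\<lambda>_. U)) (G k)" if "k \<in> I" for k
    using bound that by (intro finite_measure.integrable_const_bound[OF prob_space.finite_measure[OF PI], of _ "B k"] G) auto
  \<comment> \<open>By Fubini, coordinate \<open>k\<close> is integrated first; along it
    \<open>G k\<close> is the derivative of a function with equal values at both ends.\<close>
  have zero: "(\<integral>\<theta>. G k \<theta> \<partial>Pi\<^sub>M I (\<lambda>_. U)) = 0" if k: "k \<in> I" for k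
  proof -
    define J where "J = I - {k}"
    have IJ: "I = insert k J" "k \<notin> J" "finite J" using k I by (auto simp: J_def)
    have "(\<integral>\<theta>. G k \<theta> \<partial>Pi\<^sub>M I (\<lambda>_. U)) =
        (\<integral>\<theta>. (\<integral>t. G k (\<theta>(k := t)) \<partial>U) \<partial>Pi\<^sub>M J (\<lambda>_. U))"
      using int[OF k] IJ by (simp add: P.product_integral_insert)
    also have "\<dots> = (\<integral>\<theta>. 0 \<partial>Pi\<^sub>M J (\<lambda>_. U))"
    proof (rule Bochner_Integration.integral_cong[OF refl])
      fix \<theta> assume \<theta>: "\<theta> \<in> space (Pi\<^sub>M J (\<lambda>_. U))"
      have "(\<lambda>t. \<theta>(k := t)) \<in> U \<rightarrow>\<^sub>M Pi\<^sub>M I (\<lambda>_. U)"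
        unfolding IJ(1) by (rule measurable_component_update[OF \<theta> IJ(2)])
      then have "(\<lambda>t. G k (\<theta>(k := t))) \<in> borel_measurable U"
        by (rule measurable_compose[OF _ G[OF k]])
      then have "(\<lambda>t. G k (\<theta>(k := t))) \<in> borel_measurable borel"
        by (simp add: setsU cong: measurable_cong_sets)
      moreover have "((\<lambda>t. H k (\<theta>(k := t))) has_real_derivative G k (\<theta>(k := t))) (at t)" for t
        using deriv[OF k, of "\<theta>(k := t)"] by simp
      ultimately show "(\<integral>t. G k (\<theta>(k := t)) \<partial>U) = 0"
        unfolding U_def using bound[OF k] periodic[OF k, of \<theta>]
        by (subst integral_uniform_interval_FTC[where f = "\<lambda>t. H k (\<theta>(k := t))" and B = "B k"]) auto
    qed
    finally show ?thesis by simp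
  qed
  have "0 = (\<integral>\<theta>. (\<Sum>k\<in>I. G k \<theta>) \<partial>Pi\<^sub>M I (\<lambda>_. U))"
    using int zero by simp
  also have "\<dots> \<le> (\<integral>\<theta>. - \<eta> \<partial>Pi\<^sub>M I (\<lambda>_. U))"
    using int neg finite_measure.integrable_const[OF prob_space.finite_measure[OF PI]] by (intro integral_mono) auto
  also have "\<dots> = - \<eta>" by (simp add: prob_space.prob_space[OF PI])
  finally show False using \<open>\<eta> > 0\<close> by simp
qed

section \<open>Distributions with finite support\<close>

text \<open>A finite product measure is determined by its values on boxes, where the sum of products
  factors.\<close>

lemma PiM_point_measure:
  assumes \<Omega>: "finite \<Omega>" and I: "finite I"
    and Q: "\<And>y. y \<in> \<Omega> \<Longrightarrow> Q y \<ge> 0" "(\<Sum>y\<in>\<Omega>. Q y) = 1"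
  shows "Pi\<^sub>M I (\<lambda>_. point_measure \<Omega> (\<lambda>y. ennreal (Q y))) =
    point_measure (PiE I (\<lambda>_. \<Omega>)) (\<lambda>x. ennreal (\<Prod>i\<in>I. Q (x i)))"
proof -
  let ?P = "point_measure \<Omega> (\<lambda>y. ennreal (Q y))"
  have "(\<Sum>y\<in>\<Omega>. ennreal (Q y)) = 1"
    using Q by (simp add: sum_ennreal)
  then have "prob_space ?P"
    using \<Omega> by (intro prob_space_point_measure) auto
  then interpret product_prob_space "\<lambda>_. ?P"
    by (intro product_prob_spaceI)
  have fin: "finite (PiE I (\<lambda>_. \<Omega>))" using \<Omega> I by (intro finite_PiE) auto
  show ?thesis
  proof (rule PiM_eqI[OF I, symmetric])
    have "sets (Pi\<^sub>M I (\<lambda>_. ?P)) = sets (Pi\<^sub>M I (\<lambda>_. count_space \<Omega>))"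
      by (intro sets_PiM_cong) (auto simp: sets_point_measure)
    also have "\<dots> = sets (count_space (PiE I (\<lambda>_. \<Omega>)))"
      by (subst count_space_PiM_finite) (use I \<Omega> in \<open>auto intro: countable_finite\<close>)
    finally show "sets (point_measure (PiE I (\<lambda>_. \<Omega>)) (\<lambda>x. ennreal (\<Prod>i\<in>I. Q (x i)))) =
        sets (Pi\<^sub>M I (\<lambda>_. ?P))"
      by (simp add: sets_point_measure)
  next
    fix A assume "\<And>i. i \<in> I \<Longrightarrow> A i \<in> sets ?P"
    then have A: "A i \<subseteq> \<Omega>" if "i \<in> I" for i using that by (auto simp: sets_point_measure)
    then have sub: "PiE I A \<subseteq> PiE I (\<lambda>_. \<Omega>)" by (intro PiE_mono)
    have pos: "(\<Prod>i\<in>I. Q (x i)) \<ge> 0" if "x \<in> PiE I A" for x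
      using that A Q by (intro prod_nonneg) (auto dest: PiE_mem)
    have "emeasure (point_measure (PiE I (\<lambda>_. \<Omega>)) (\<lambda>x. ennreal (\<Prod>i\<in>I. Q (x i)))) (PiE I A) =
        (\<Sum>x\<in>PiE I A. ennreal (\<Prod>i\<in>I. Q (x i)))"
      using fin sub by (rule emeasure_point_measure_finite)
    also have "\<dots> = ennreal (\<Sum>x\<in>PiE I A. \<Prod>i\<in>I. Q (x i))"
      using pos by (rule sum_ennreal)
    also have "(\<Sum>x\<in>PiE I A. \<Prod>i\<in>I. Q (x i)) = (\<Prod>i\<in>I. \<Sum>y\<in>A i. Q y)"
      using I A \<Omega> by (intro prod_sum_PiE[symmetric]) (auto dest: finite_subset)
    also have "ennreal \<dots> = (\<Prod>i\<in>I. ennreal (\<Sum>y\<in>A i. Q y))"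
      using A Q by (intro prod_ennreal[symmetric] sum_nonneg) auto
    also have "\<dots> = (\<Prod>i\<in>I. emeasure ?P (A i))"
    proof (rule prod.cong[OF refl])
      fix i assume i: "i \<in> I"
      have "emeasure ?P (A i) = (\<Sum>y\<in>A i. ennreal (Q y))"
        using \<Omega> A[OF i] by (rule emeasure_point_measure_finite)
      also have "\<dots> = ennreal (\<Sum>y\<in>A i. Q y)"
        using A[OF i] Q by (intro sum_ennreal) auto
      finally show "ennreal (\<Sum>y\<in>A i. Q y) = emeasure ?P (A i)" by simp
    qed
    finally show "emeasure (point_measure (PiE I (\<lambda>_. \<Omega>)) (\<lambda>x. ennreal (\<Prod>i\<in>I. Q (x i)))) (PiE I A) =
        (\<Prod>i\<in>I. emeasure ?P (A i))" .
  qed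
qed

lemma space_example_space: "space (example_space d) = unit_ball d \<times> {-1, 1}"
  by (auto simp: example_space_def space_pair_measure space_restrict_space space_PiM unit_ball_def)

text \<open>Turns the probability of an output event into a finite sum over samples, polynomial in
  the masses. An i.i.d. sample from the image distribution is the coordinatewise image under
  \<open>e\<close> of one from the point measure.\<close>

lemma output_distribution_finite_support:
  assumes \<Omega>: "finite \<Omega>" and Q: "\<And>y. y \<in> \<Omega> \<Longrightarrow> Q y \<ge> 0" "(\<Sum>y\<in>\<Omega>. Q y) = 1"
    and e: "e \<in> \<Omega> \<rightarrow> space (example_space d)"
    and A: "(\<lambda>s. A (map s [0..<n])) \<in> Pi\<^sub>M {..<n} (\<lambda>_. example_space d) \<rightarrow>\<^sub>M prob_algebra M"
    and S: "S \<in> sets M"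
  shows "measure (output_distribution n
      (distr (point_measure \<Omega> (\<lambda>y. ennreal (Q y))) (example_space d) e) A) S =
    (\<Sum>X\<in>{..<n} \<rightarrow>\<^sub>E \<Omega>. (\<Prod>i<n. Q (X i)) * measure (A (map (\<lambda>i. e (X i)) [0..<n])) S)"
proof -
  let ?P = "point_measure \<Omega> (\<lambda>y. ennreal (Q y))" and ?E = "example_space d"
  define D where "D = distr ?P ?E e"
  have P: "prob_space ?P"
    using \<Omega> Q by (intro prob_space_point_measure) (auto simp: sum_ennreal)
  have e': "e \<in> ?P \<rightarrow>\<^sub>M ?E" using e by simp
  have D: "prob_space D" unfolding D_def by (rule prob_space.prob_space_distr[OF P e'])
  have setsD: "sets D = sets ?E" by (simp add: D_def)
  have setsPi: "sets (Pi\<^sub>M {..<n} (\<lambda>_. D)) = sets (Pi\<^sub>M {..<n} (\<lambda>_. ?E))"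
    by (intro sets_PiM_cong refl setsD)
  have eD: "e \<in> ?P \<rightarrow>\<^sub>M D" using e' by (simp add: setsD cong: measurable_cong_sets)
  have "distr (Pi\<^sub>M {..<n} (\<lambda>_. ?P)) (Pi\<^sub>M {..<n} (\<lambda>_. D)) (compose {..<n} e) = Pi\<^sub>M {..<n} (\<lambda>_. distr ?P D e)"
    by (rule distr_PiM_finite_prob_space') (use P D eD in auto)
  also have "distr ?P D e = D" unfolding D_def by (rule distr_cong) auto
  finally have PiD: "Pi\<^sub>M {..<n} (\<lambda>_. D) = distr (Pi\<^sub>M {..<n} (\<lambda>_. ?P)) (Pi\<^sub>M {..<n} (\<lambda>_. D)) (compose {..<n} e)" by simp
  have comp: "compose {..<n} e \<in> Pi\<^sub>M {..<n} (\<lambda>_. ?P) \<rightarrow>\<^sub>M Pi\<^sub>M {..<n} (\<lambda>_. D)"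
  proof -
    have "(\<lambda>X. \<lambda>i\<in>{..<n}. e (X i)) \<in> Pi\<^sub>M {..<n} (\<lambda>_. ?P) \<rightarrow>\<^sub>M Pi\<^sub>M {..<n} (\<lambda>_. D)"
      by (intro measurable_restrict measurable_compose[OF _ eD] measurable_component_singleton)
    then show ?thesis by (simp add: compose_def[abs_def])
  qed
  have A': "(\<lambda>s. A (map s [0..<n])) \<in> Pi\<^sub>M {..<n} (\<lambda>_. D) \<rightarrow>\<^sub>M prob_algebra M"
    using A setsPi by (simp cong: measurable_cong_sets)
  have meas: "(\<lambda>s. measure (A (map s [0..<n])) S) \<in> borel_measurable (Pi\<^sub>M {..<n} (\<lambda>_. D))"
    by (rule measurable_compose[OF A' measurable_measure_prob_algebra[OF S]])
  interpret PD: prob_space "Pi\<^sub>M {..<n} (\<lambda>_. D)" by (intro prob_space_PiM D)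
  have "measure (output_distribution n D A) S = (\<integral>s. measure (A (map s [0..<n])) S \<partial>Pi\<^sub>M {..<n} (\<lambda>_. D))"
    unfolding output_distribution_def by (rule PD.measure_bind[OF measurable_prob_algebraD[OF A'] S])
  also have "\<dots> = (\<integral>X. measure (A (map (compose {..<n} e X) [0..<n])) S \<partial>Pi\<^sub>M {..<n} (\<lambda>_. ?P))"
    by (subst PiD) (rule integral_distr[OF comp meas])
  also have "\<dots> = (\<Sum>X\<in>{..<n} \<rightarrow>\<^sub>E \<Omega>. (\<Prod>i<n. Q (X i)) * measure (A (map (compose {..<n} e X) [0..<n])) S)"
  proof -
    have PiP: "Pi\<^sub>M {..<n} (\<lambda>_. ?P) = point_measure ({..<n} \<rightarrow>\<^sub>E \<Omega>) (\<lambda>X. ennreal (\<Prod>i<n. Q (X i)))"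
      by (rule PiM_point_measure[OF \<Omega> finite_lessThan Q])
    have "(\<Prod>i<n. Q (X i)) \<ge> 0" if "X \<in> {..<n} \<rightarrow>\<^sub>E \<Omega>" for X
      using PiE_mem[OF that] by (intro prod_nonneg ballI Q(1)) auto
    then show ?thesis
      unfolding PiP using \<Omega> by (subst lebesgue_integral_point_measure_finite) (auto intro!: finite_PiE)
  qed
  also have "\<dots> = (\<Sum>X\<in>{..<n} \<rightarrow>\<^sub>E \<Omega>. (\<Prod>i<n. Q (X i)) * measure (A (map (\<lambda>i. e (X i)) [0..<n])) S)"
    by (intro sum.cong refl arg_cong2[where f = "(*)"] arg_cong2[where f = measure] arg_cong[where f = A])
      (auto simp: compose_def)
  finally show ?thesis unfolding D_def .
qed

lemma measure_distr_point_measure: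
  assumes "finite \<Omega>" "\<And>y. y \<in> \<Omega> \<Longrightarrow> Q y \<ge> 0" "e \<in> \<Omega> \<rightarrow> space E" "S \<in> sets E"
  shows "measure (distr (point_measure \<Omega> (\<lambda>y. ennreal (Q y))) E e) S = (\<Sum>y\<in>{y \<in> \<Omega>. e y \<in> S}. Q y)"
proof -
  have "measure (distr (point_measure \<Omega> (\<lambda>y. ennreal (Q y))) E e) S =
      measure (point_measure \<Omega> (\<lambda>y. ennreal (Q y))) (e -` S \<inter> \<Omega>)"
    using assms by (subst measure_distr) (auto simp: space_point_measure)
  also have "e -` S \<inter> \<Omega> = {y \<in> \<Omega>. e y \<in> S}" by auto
  finally show ?thesis
    using assms by (subst (asm) measure_point_measure_finite_if) auto
qed

section \<open>Normal vectors of halfspaces\<close>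

definition grid :: "nat \<Rightarrow> nat \<Rightarrow> (nat \<Rightarrow> real) set" where
  "grid d m = {z \<in> unit_ball d. \<forall>j<d. \<exists>i::int. z j = i / m}"

text \<open>A halfspace is replaced by one fitted to its finitely many values on the grid, so that its normal
  vector depends measurably on the predictions.\<close>

definition fit :: "nat \<Rightarrow> nat \<Rightarrow> ((nat \<Rightarrow> real) \<Rightarrow> int) \<Rightarrow> nat \<Rightarrow> real" where
  "fit d m h = (SOME w. \<forall>z\<in>grid d m. halfspace d w z = h z)"

text \<open>A unit vector, or \<open>0\<close> if the fitted vector vanishes on \<open>{..<d}\<close> (division by zero).\<close>

definition normal :: "nat \<Rightarrow> nat \<Rightarrow> ((nat \<Rightarrow> real) \<Rightarrow> int) \<Rightarrow> nat \<Rightarrow> real" where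
  "normal d m h j = fit d m h j / L2_set (fit d m h) {..<d}"

lemma unit_ball_coordinate:
  assumes "z \<in> unit_ball d" "j < d"
  shows "\<bar>z j\<bar> \<le> 1"
proof -
  have "\<bar>z j\<bar> \<le> L2_set (\<lambda>j. \<bar>z j\<bar>) {..<d}" using assms(2) by (intro member_le_L2_set) auto
  also have "\<dots> \<le> 1" using assms(1) by (simp add: unit_ball_def L2_set_def)
  finally show ?thesis .
qed

lemma finite_grid:
  assumes "m > 0"
  shows "finite (grid d m)"
proof (rule finite_subset)
  show "grid d m \<subseteq> {..<d} \<rightarrow>\<^sub>E (\<lambda>i::int. i / m) ` {- int m..int m}"
  proof
    fix z assume z: "z \<in> grid d m"
    show "z \<in> {..<d} \<rightarrow>\<^sub>E (\<lambda>i::int. i / m) ` {- int m..int m}"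
    proof (rule PiE_I)
      fix j assume j: "j \<in> {..<d}"
      then obtain i :: int where i: "z j = i / m" using z by (auto simp: grid_def)
      have "\<bar>z j\<bar> \<le> 1" using unit_ball_coordinate[of z d j] z j by (auto simp: grid_def)
      then have "\<bar>real_of_int i\<bar> \<le> m" using assms by (simp add: i abs_divide)
      then have "i \<in> {- int m..int m}" by auto
      then show "z j \<in> (\<lambda>i::int. i / m) ` {- int m..int m}" using i by blast
    next
      fix j assume "j \<notin> {..<d}"
      then show "z j = undefined" using z by (auto simp: grid_def unit_ball_def dest: PiE_arb)
    qed
  qed
qed (intro finite_PiE, auto)

lemma sum_normal_square_le: "(\<Sum>j<d. (normal d m h j)\<^sup>2) \<le> 1"
proof -
  have "(\<Sum>j<d. (normal d m h j)\<^sup>2) = (\<Sum>j<d. (fit d m h j)\<^sup>2) / (L2_set (fit d m h) {..<d})\<^sup>2"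
    by (simp add: normal_def power_divide sum_divide_distrib)
  also have "\<dots> \<le> 1" by (simp add: L2_set_def sum_nonneg divide_le_eq_1)
  finally show ?thesis .
qed

lemma normal_restrict: "normal d m (restrict h (grid d m)) = normal d m h"
  by (simp add: normal_def[abs_def] fit_def)

text \<open>\<open>normal\<close> factors through the finite set of labellings of the grid, where
  every function is measurable.\<close>

lemma normal_measurable:
  assumes m: "m > 0" and M: "\<And>x. x \<in> unit_ball d \<Longrightarrow> (\<lambda>h. h x) \<in> M \<rightarrow>\<^sub>M count_space {-1, 1}"
  shows "(\<lambda>h. normal d m h j) \<in> borel_measurable M"
proof -
  have "(\<lambda>h. \<lambda>z\<in>grid d m. h z) \<in> M \<rightarrow>\<^sub>M Pi\<^sub>M (grid d m) (\<lambda>_. count_space {-1, 1})"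
    by (intro measurable_restrict M) (auto simp: grid_def)
  also have "Pi\<^sub>M (grid d m) (\<lambda>_. count_space {-1, 1}) = count_space (grid d m \<rightarrow>\<^sub>E {-1, 1})"
    by (intro count_space_PiM_finite finite_grid m) auto
  finally have "(\<lambda>h. restrict h (grid d m)) \<in> M \<rightarrow>\<^sub>M count_space (grid d m \<rightarrow>\<^sub>E {-1, 1})" .
  from measurable_compose[OF this, of "\<lambda>h. normal d m h j" borel]
  show ?thesis by (simp add: normal_restrict)
qed

text \<open>The idea is to shift \<open>x\<close> in the direction of the normal vector and to round to the grid, where the
  fitted halfspace agrees with \<open>h\<close>.\<close>

lemma normal_margin:
  assumes h: "h \<in> halfspace d ` Rd d" and d: "d \<ge> 1" and m: "10 * d / \<gamma> \<le> m"
    and \<gamma>: "0 < \<gamma>" "\<gamma> \<le> 1 / 36" and x: "L2_set x {..<d} \<le> 1 / 2"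
    and robust: "\<And>z. z \<in> unit_ball d \<Longrightarrow> L2_set (\<lambda>j. z j - x j) {..<d} \<le> 0.9 * \<gamma> \<Longrightarrow> h z = -1"
  shows "(\<Sum>j<d. normal d m h j * x j) \<le> - (0.45 * \<gamma>)"
proof -
  define w where "w = fit d m h"
  define u where "u = normal d m h"
  define l where "l = L2_set w {..<d}"
  have m0: "m > 0" using m d \<gamma> by (cases m) (auto simp: divide_le_0_iff)
  have dm: "d / m \<le> \<gamma> / 10" using m m0 \<gamma> by (simp add: field_simps)
  have fit: "halfspace d w z = h z" if "z \<in> grid d m" for z
  proof -
    have "\<exists>w. \<forall>z\<in>grid d m. halfspace d w z = h z" using h by auto
    from someI_ex[OF this] show ?thesis using that by (simp add: w_def fit_def)
  qed
  have norm_u: "L2_set u {..<d} \<le> 1"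
    using sum_normal_square_le[of d m h] by (simp add: L2_set_def u_def)
  \<comment> \<open>Shifting by \<open>s * \<gamma> * u\<close> and rounding with error at most
    \<open>d / m <= \<gamma> / 10\<close> stays within \<open>0.9 * \<gamma>\<close> of
    \<open>x\<close> as long as \<open>s <= 0.8\<close>.\<close>
  have round: "\<exists>z. L2_set (\<lambda>j. z j - x j) {..<d} \<le> (s + 0.1) * \<gamma> \<and> (\<Sum>j<d. w j * z j) < 0 \<and>
      (\<Sum>j<d. u j * x j) + s * \<gamma> * (L2_set u {..<d})\<^sup>2 - 0.1 * \<gamma> \<le> (\<Sum>j<d. u j * z j)"
    if s: "0 \<le> s" "s \<le> 0.8" for s
  proof -
    define y where "y j = x j + s * \<gamma> * u j" for j
    define z where "z = (\<lambda>j\<in>{..<d}. real_of_int \<lfloor>y j * m\<rfloor> / m)"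
    have err: "\<bar>z j - y j\<bar> \<le> 1 / m" if "j < d" for j
    proof -
      have "\<bar>z j - y j\<bar> = \<bar>real_of_int \<lfloor>y j * m\<rfloor> - y j * m\<bar> / m"
        using that m0 by (simp add: z_def abs_divide[symmetric] field_simps del: abs_divide)
      also have "\<dots> \<le> 1 / m" by (intro divide_right_mono) linarith+
      finally show ?thesis .
    qed
    have "L2_set (\<lambda>j. z j - y j) {..<d} \<le> (\<Sum>j<d. \<bar>z j - y j\<bar>)" by (rule L2_set_le_sum_abs)
    also have "\<dots> \<le> (\<Sum>j<d. 1 / m)" by (intro sum_mono err) simp
    also have "\<dots> \<le> \<gamma> / 10" using dm by simp
    finally have zy: "L2_set (\<lambda>j. z j - y j) {..<d} \<le> \<gamma> / 10" .
    have yx: "L2_set (\<lambda>j. y j - x j) {..<d} \<le> s * \<gamma>"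
    proof -
      have "L2_set (\<lambda>j. y j - x j) {..<d} = (s * \<gamma>) * L2_set u {..<d}"
        unfolding y_def using s \<gamma> by (subst L2_set_right_distrib) auto
      also have "\<dots> \<le> s * \<gamma>" using norm_u s \<gamma> by (intro mult_left_le) auto
      finally show ?thesis .
    qed
    have zx: "L2_set (\<lambda>j. z j - x j) {..<d} \<le> (s + 0.1) * \<gamma>"
      using L2_set_triangle_ineq[of "\<lambda>j. z j - y j" "\<lambda>j. y j - x j" "{..<d}"] zy yx
      by (simp add: algebra_simps)
    have "L2_set z {..<d} \<le> L2_set (\<lambda>j. z j - x j) {..<d} + L2_set x {..<d}"
      using L2_set_triangle_ineq[of "\<lambda>j. z j - x j" x "{..<d}"] by simp
    also have "\<dots> \<le> (0.8 + 0.1) * (1 / 36) + 1 / 2"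
      using s \<gamma> by (intro add_mono order_trans[OF zx] x mult_mono) auto
    also have "\<dots> \<le> 1" by simp
    finally have ball: "z \<in> unit_ball d" by (auto simp: unit_ball_def z_def)
    then have grid: "z \<in> grid d m" by (auto simp: grid_def z_def)
    have "(s + 0.1) * \<gamma> \<le> 0.9 * \<gamma>" using s \<gamma> by (intro mult_right_mono) auto
    then have "h z = -1" using zx by (intro robust ball) simp
    then have neg: "(\<Sum>j<d. w j * z j) < 0"
      using fit[OF grid] ball by (auto simp: halfspace_def split: if_splits)
    have "- (\<Sum>j<d. u j * (z j - y j)) \<le> (\<Sum>j<d. \<bar>u j\<bar> * \<bar>z j - y j\<bar>)"
      unfolding sum_negf[symmetric] by (intro sum_mono) (simp add: abs_mult[symmetric])
    also have "\<dots> \<le> L2_set u {..<d} * L2_set (\<lambda>j. z j - y j) {..<d}" by (rule L2_set_mult_ineq)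
    also have "\<dots> \<le> 1 * (\<gamma> / 10)" using norm_u zy by (intro mult_mono) auto
    finally have "- (\<gamma> / 10) \<le> (\<Sum>j<d. u j * (z j - y j))" by simp
    moreover have "(\<Sum>j<d. u j * z j) = (\<Sum>j<d. u j * x j + s * \<gamma> * (u j)\<^sup>2 + u j * (z j - y j))"
      by (intro sum.cong) (auto simp: y_def algebra_simps power2_eq_square)
    moreover have "(L2_set u {..<d})\<^sup>2 = (\<Sum>j<d. (u j)\<^sup>2)" by (simp add: L2_set_def sum_nonneg)
    ultimately have "(\<Sum>j<d. u j * x j) + s * \<gamma> * (L2_set u {..<d})\<^sup>2 - 0.1 * \<gamma> \<le> (\<Sum>j<d. u j * z j)"
      by (simp add: sum.distrib sum_distrib_left)
    then show ?thesis using zx neg by blast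
  qed
  \<comment> \<open>For \<open>w = 0\<close> the fitted halfspace would be constantly 1, but already
    the shift 0 yields a grid point labelled -1.\<close>
  have l: "l > 0"
  proof (rule ccontr)
    assume "\<not> l > 0"
    then have "l = 0" unfolding l_def by (meson L2_set_nonneg not_le order.antisym)
    then have "w j = 0" if "j < d" for j using that by (auto simp: l_def L2_set_eq_0_iff)
    then show False using round[of 0] by auto
  qed
  have u_eq: "u j = w j / l" for j by (simp add: u_def normal_def w_def l_def)
  have "L2_set u {..<d} = 1"
  proof -
    have "l * L2_set u {..<d} = L2_set (\<lambda>j. l * u j) {..<d}" using l by (intro L2_set_right_distrib) auto
    also have "\<dots> = l" using l by (simp add: u_eq l_def)
    finally show ?thesis using l by simp
  qed
  \<comment> \<open>As \<open>u\<close> is a unit vector, the shift 0.6 less the rounding error 0.1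
    leaves \<open>0.5 * \<gamma>\<close>, more than the claimed
    \<open>0.45 * \<gamma>\<close>.\<close>
  moreover obtain z where "(\<Sum>j<d. w j * z j) < 0"
    "(\<Sum>j<d. u j * x j) + 0.6 * \<gamma> * (L2_set u {..<d})\<^sup>2 - 0.1 * \<gamma> \<le> (\<Sum>j<d. u j * z j)"
    using round[of "0.6"] by auto
  moreover have "(\<Sum>j<d. u j * z j) = (\<Sum>j<d. w j * z j) / l"
    by (simp add: u_eq sum_divide_distrib)
  then have "(\<Sum>j<d. u j * z j) < 0"
    using \<open>(\<Sum>j<d. w j * z j) < 0\<close> l by (simp add: divide_neg_pos)
  ultimately have "(\<Sum>j<d. u j * x j) + 0.5 * \<gamma> < 0" by simp
  then show ?thesis using \<gamma> by (simp add: u_def)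
qed

section \<open>The fingerprinting distributions\<close>

definition signs :: "complex set" where
  "signs = {Complex 1 1, Complex 1 (-1), Complex (-1) 1, Complex (-1) (-1)}"

lemma finite_signs [simp]: "finite signs"
  by (simp add: signs_def)

lemma sum_signs: "(\<Sum>x\<in>signs. f x) =
    f (Complex 1 1) + f (Complex 1 (-1)) + f (Complex (-1) 1) + f (Complex (-1) (-1))"
  by (simp add: signs_def complex_eq_iff add_ac)

lemma norm_signs: "x \<in> signs \<Longrightarrow> (norm x)\<^sup>2 = 2"
  by (auto simp: signs_def cmod_def)

text \<open>The number \<open>3 / 2\<close> is a rational bound for \<open>sqrt 2\<close>, the norm
  of a sign vector.\<close>

lemma inner_signs_le:
  assumes "x \<in> signs" "norm u \<le> 1"
  shows "\<bar>u \<bullet> x\<bar> \<le> 3 / 2"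
proof -
  have "(norm x)\<^sup>2 \<le> (3 / 2)\<^sup>2" using norm_signs[OF assms(1)] by (simp add: power2_eq_square)
  then have "norm x \<le> 3 / 2" by (rule power2_le_imp_le) simp
  have "\<bar>u \<bullet> x\<bar> \<le> norm u * norm x" by (rule Cauchy_Schwarz_ineq2)
  also have "\<dots> \<le> 1 * (3 / 2)" using assms(2) \<open>norm x \<le> 3 / 2\<close> by (intro mult_mono) auto
  finally show ?thesis by simp
qed

text \<open>The upper bound on \<open>b\<close> keeps the densities of single blocks at least
  \<open>5 / 32\<close>. The last assumption makes the mean \<open>b * K\<close> of the correlation
  at least 40 times its standard deviation, which is of order \<open>sqrt K\<close>.\<close>

locale torus_family =
  fixes b :: real and K :: nat
  assumes b_pos: "b > 0" and b_le: "b \<le> 1 / 4" and b_K: "40 \<le> b * sqrt K"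
begin

definition cube :: "(nat \<Rightarrow> complex) set" where
  "cube = {..<K} \<rightarrow>\<^sub>E signs"

text \<open>The uniform distribution on \<open>signs\<close>, tilted linearly: the mean becomes
  \<open>b\<close> times \<open>cis t\<close>, while the second moments do not depend on
  \<open>t\<close>.\<close>

definition block :: "real \<Rightarrow> complex \<Rightarrow> real" where
  "block t x = (1 + b * (cis t \<bullet> x)) / 4"

definition dens :: "(nat \<Rightarrow> real) \<Rightarrow> (nat \<Rightarrow> complex) \<Rightarrow> real" where
  "dens \<theta> x = (\<Prod>k<K. block (\<theta> k) (x k))"

text \<open>Here and below, a prime with an index \<open>k\<close> marks the partial derivative in
  the angle \<open>\<theta> k\<close>.\<close>

definition dens' :: "nat \<Rightarrow> (nat \<Rightarrow> real) \<Rightarrow> (nat \<Rightarrow> complex) \<Rightarrow> real" where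
  "dens' k \<theta> x = b * ((\<i> * cis (\<theta> k)) \<bullet> x k) / 4 * (\<Prod>l\<in>{..<K} - {k}. block (\<theta> l) (x l))"

text \<open>The mean of the correlation \<open>\<Sum>k<K. cis (\<theta> k) \<bullet> x k\<close> is \<open>b * K\<close>; the gate opens between \<open>1 / 2\<close> and
  \<open>3 / 4\<close> of it.\<close>

definition gate :: "(nat \<Rightarrow> real) \<Rightarrow> (nat \<Rightarrow> complex) \<Rightarrow> real" where
  "gate \<theta> x = ((\<Sum>k<K. cis (\<theta> k) \<bullet> x k) - b * K / 2) * (4 / (b * K))"

definition mass_Some :: "(nat \<Rightarrow> real) \<Rightarrow> (nat \<Rightarrow> complex) \<Rightarrow> real" where
  "mass_Some \<theta> x = dens \<theta> x * cutoff (gate \<theta> x)"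

definition mass_Some' :: "nat \<Rightarrow> (nat \<Rightarrow> real) \<Rightarrow> (nat \<Rightarrow> complex) \<Rightarrow> real" where
  "mass_Some' k \<theta> x = dens' k \<theta> x * cutoff (gate \<theta> x) +
     dens \<theta> x * (cutoff' (gate \<theta> x) * (((\<i> * cis (\<theta> k)) \<bullet> x k) * (4 / (b * K))))"

text \<open>The extra example \<open>None\<close> receives the mass that the cutoff removes from the cube.\<close>

definition points :: "(nat \<Rightarrow> complex) option set" where
  "points = insert None (Some ` cube)"

definition mass :: "(nat \<Rightarrow> real) \<Rightarrow> (nat \<Rightarrow> complex) option \<Rightarrow> real" where
  "mass \<theta> y = (case y of None \<Rightarrow> 1 - (\<Sum>x\<in>cube. mass_Some \<theta> x) | Some x \<Rightarrow> mass_Some \<theta> x)"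

definition mass' :: "nat \<Rightarrow> (nat \<Rightarrow> real) \<Rightarrow> (nat \<Rightarrow> complex) option \<Rightarrow> real" where
  "mass' k \<theta> y = (case y of None \<Rightarrow> - (\<Sum>x\<in>cube. mass_Some' k \<theta> x) | Some x \<Rightarrow> mass_Some' k \<theta> x)"

lemma K_pos: "K > 0"
  using b_K by (cases K) auto

lemma b2K: "1600 \<le> b * (b * K)"
proof -
  have "40 * 40 \<le> (b * sqrt K) * (b * sqrt K)"
    using b_K by (intro mult_mono) auto
  also have "\<dots> = b * (b * K)" by simp
  finally show ?thesis by simp
qed

text \<open>The left side is the bound 4 on \<open>cutoff'\<close> times the slope
  \<open>4 / (b * K)\<close> of \<open>gate\<close>. Differentiating the cutoff is thus cheap
  compared with the score, which is of order \<open>b\<close>.\<close>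

lemma inverse_bK: "16 / (b * K) \<le> b / 100"
  using b2K b_pos K_pos by (simp add: field_simps)

lemma finite_cube [simp]: "finite cube"
  by (simp add: cube_def finite_PiE)

lemma finite_points [simp]: "finite points"
  by (simp add: points_def)

lemma sum_points: "(\<Sum>y\<in>points. f y) = f None + (\<Sum>x\<in>cube. f (Some x))"
  unfolding points_def by (subst sum.insert) (auto simp: sum.reindex)

lemma cube_signs: "x \<in> cube \<Longrightarrow> k < K \<Longrightarrow> x k \<in> signs"
  by (auto simp: cube_def)

section \<open>Moments of the biased sign vectors\<close>

lemma block_ge: "x \<in> signs \<Longrightarrow> block t x \<ge> 5 / 32"
  using inner_signs_le[of x "cis t"] mult_mono[OF b_le, of "\<bar>cis t \<bullet> x\<bar>" "3 / 2"] b_pos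
    abs_ge_minus_self[of "b * (cis t \<bullet> x)"]
  by (simp add: block_def abs_mult)

lemma sum_block: "(\<Sum>x\<in>signs. block t x) = 1"
  and sum_block_inner: "(\<Sum>x\<in>signs. block t x * (u \<bullet> x)) = b * (cis t \<bullet> u)"
  and sum_block_inner_square: "(\<Sum>x\<in>signs. block t x * (u \<bullet> x)\<^sup>2) = (norm u)\<^sup>2"
  unfolding block_def
  by (simp_all add: sum_signs inner_complex_def cmod_power2) (simp_all add: power2_eq_square field_simps)

lemma dens_nonneg: "x \<in> cube \<Longrightarrow> dens \<theta> x \<ge> 0"
  unfolding dens_def by (intro prod_nonneg ballI order_trans[OF _ block_ge]) (auto dest: cube_signs)

lemma sum_dens: "(\<Sum>x\<in>cube. dens \<theta> x) = 1"
  unfolding cube_def dens_def by (subst prod_sum_PiE[symmetric]) (auto simp: sum_block)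

lemma dens_second_moment:
  assumes "\<And>k. k < K \<Longrightarrow> (\<Sum>x\<in>signs. block (\<theta> k) x * g k x) = 0"
  shows "(\<Sum>x\<in>cube. dens \<theta> x * (\<Sum>k<K. g k (x k))\<^sup>2) =
    (\<Sum>k<K. \<Sum>x\<in>signs. block (\<theta> k) x * (g k x)\<^sup>2)"
  unfolding cube_def dens_def
  using assms by (intro sum_PiE_second_moment) (auto simp: sum_block)

text \<open>By independence the variance is the sum of the variances over the blocks, and each is at
  most the second moment given by \<open>sum_block_inner_square\<close>.\<close>

lemma dens_variance:
  "(\<Sum>x\<in>cube. dens \<theta> x * ((\<Sum>k<K. u k \<bullet> x k) - b * (\<Sum>k<K. cis (\<theta> k) \<bullet> u k))\<^sup>2) \<le> (\<Sum>k<K. (norm (u k))\<^sup>2)"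
proof -
  define c where "c k = b * (cis (\<theta> k) \<bullet> u k)" for k
  have "(\<Sum>x\<in>cube. dens \<theta> x * ((\<Sum>k<K. u k \<bullet> x k) - b * (\<Sum>k<K. cis (\<theta> k) \<bullet> u k))\<^sup>2) =
      (\<Sum>x\<in>cube. dens \<theta> x * (\<Sum>k<K. u k \<bullet> x k - c k)\<^sup>2)"
    by (simp add: c_def sum_subtractf sum_distrib_left)
  also have "\<dots> = (\<Sum>k<K. \<Sum>x\<in>signs. block (\<theta> k) x * (u k \<bullet> x - c k)\<^sup>2)"
    by (rule dens_second_moment)
      (simp add: right_diff_distrib sum_subtractf sum_distrib_right[symmetric] sum_block sum_block_inner c_def)
  also have "\<dots> \<le> (\<Sum>k<K. (norm (u k))\<^sup>2)"
  proof (rule sum_mono)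
    fix k
    have "(\<Sum>x\<in>signs. block (\<theta> k) x * (u k \<bullet> x - c k)\<^sup>2) =
        (\<Sum>x\<in>signs. block (\<theta> k) x * (u k \<bullet> x)\<^sup>2 - 2 * c k * (block (\<theta> k) x * (u k \<bullet> x)) + (c k)\<^sup>2 * block (\<theta> k) x)"
      by (intro sum.cong refl) (simp add: power2_eq_square algebra_simps)
    also have "\<dots> = (norm (u k))\<^sup>2 - 2 * c k * c k + (c k)\<^sup>2"
      by (simp only: sum.distrib sum_subtractf sum_distrib_left[symmetric] sum_block sum_block_inner
          sum_block_inner_square) (simp add: c_def)
    also have "\<dots> \<le> (norm (u k))\<^sup>2" by (simp add: power2_eq_square)
    finally show "(\<Sum>x\<in>signs. block (\<theta> k) x * (u k \<bullet> x - c k)\<^sup>2) \<le> (norm (u k))\<^sup>2" .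
  qed
  finally show ?thesis .
qed

lemma mass_nonneg: "y \<in> points \<Longrightarrow> mass \<theta> y \<ge> 0"
proof -
  have "(\<Sum>x\<in>cube. mass_Some \<theta> x) \<le> (\<Sum>x\<in>cube. dens \<theta> x)"
    unfolding mass_Some_def
    by (intro sum_mono mult_left_le cutoff_le_1 dens_nonneg)
  then show "y \<in> points \<Longrightarrow> mass \<theta> y \<ge> 0"
    using dens_nonneg[of _ \<theta>] cutoff_nonneg
    by (auto simp: mass_def points_def sum_dens mass_Some_def)
qed

lemma sum_mass: "(\<Sum>y\<in>points. mass \<theta> y) = 1"
  by (simp add: sum_points mass_def)

lemma mass_le_1: "y \<in> points \<Longrightarrow> mass \<theta> y \<le> 1"
  using member_le_sum[of y points "mass \<theta>"] mass_nonneg by (simp add: sum_mass)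

lemma sum_mass': "(\<Sum>y\<in>points. mass' k \<theta> y) = 0"
  by (simp add: sum_points mass'_def)

section \<open>Scores and directional derivatives of the masses\<close>

text \<open>The logarithmic derivative of \<open>block t x\<close> in \<open>t\<close>.\<close>

definition score :: "real \<Rightarrow> complex \<Rightarrow> real" where
  "score t x = b * ((\<i> * cis t) \<bullet> x) / (1 + b * (cis t \<bullet> x))"

lemma block_score: "x \<in> signs \<Longrightarrow> block t x * score t x = b * ((\<i> * cis t) \<bullet> x) / 4"
  using block_ge[of x t] by (simp add: block_def score_def field_simps)

lemma dens'_eq: "x \<in> cube \<Longrightarrow> k < K \<Longrightarrow> dens' k \<theta> x = dens \<theta> x * score (\<theta> k) (x k)"
  by (simp add: dens'_def dens_def prod.remove[of "{..<K}" k] block_score[symmetric] cube_signs mult_ac)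

lemma abs_score_le: "x \<in> signs \<Longrightarrow> \<bar>score t x\<bar> \<le> 2 * b * \<bar>(\<i> * cis t) \<bullet> x\<bar>"
proof -
  assume x: "x \<in> signs"
  have "1 + b * (cis t \<bullet> x) \<ge> 1 / 2" using block_ge[OF x, of t] by (simp add: block_def)
  then have "b * \<bar>(\<i> * cis t) \<bullet> x\<bar> / (1 + b * (cis t \<bullet> x)) \<le> b * \<bar>(\<i> * cis t) \<bullet> x\<bar> / (1 / 2)"
    using b_pos by (intro divide_left_mono) auto
  moreover have "\<bar>score t x\<bar> = b * \<bar>(\<i> * cis t) \<bullet> x\<bar> / (1 + b * (cis t \<bullet> x))"
    using b_pos \<open>1 + b * (cis t \<bullet> x) \<ge> 1 / 2\<close> by (simp add: score_def abs_mult)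
  ultimately show ?thesis by (simp add: mult_ac)
qed

lemma norm_i_cis: "norm (\<i> * cis t) = 1"
  by (simp add: norm_mult)

lemma cis_inner_i_cis: "cis t \<bullet> (\<i> * cis t) = 0"
  by (simp add: inner_complex_def)

lemma sum_block_score: "(\<Sum>x\<in>signs. block t x * score t x) = 0"
  by (simp add: block_score cong: sum.cong) (simp add: sum_signs inner_complex_def field_simps)

text \<open>Bounds the Fisher information of one angle: the denominator of the score is at least
  \<open>1 / 2\<close>, and its numerator has second moment \<open>b^2\<close>.\<close>

lemma sum_block_score_square: "(\<Sum>x\<in>signs. block t x * (score t x)\<^sup>2) \<le> (2 * b)\<^sup>2"
proof -
  have "(\<Sum>x\<in>signs. block t x * (score t x)\<^sup>2) \<le> (\<Sum>x\<in>signs. block t x * ((2 * b)\<^sup>2 * ((\<i> * cis t) \<bullet> x)\<^sup>2))"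
  proof (intro sum_mono mult_left_mono)
    fix x assume x: "x \<in> signs"
    have "(\<bar>score t x\<bar>)\<^sup>2 \<le> (2 * b * \<bar>(\<i> * cis t) \<bullet> x\<bar>)\<^sup>2"
      using abs_score_le[OF x] by (intro power_mono) auto
    then show "(score t x)\<^sup>2 \<le> (2 * b)\<^sup>2 * ((\<i> * cis t) \<bullet> x)\<^sup>2" by (simp add: power_mult_distrib)
    show "0 \<le> block t x" using block_ge[OF x, of t] by simp
  qed
  also have "\<dots> = (2 * b)\<^sup>2 * (\<Sum>x\<in>signs. block t x * ((\<i> * cis t) \<bullet> x)\<^sup>2)"
    by (simp add: sum_distrib_left mult_ac)
  finally show ?thesis by (simp add: sum_block_inner_square norm_i_cis)
qed

lemma sum_mass_Some'_eq:
  assumes x: "x \<in> cube"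
  shows "(\<Sum>k<K. a k * mass_Some' k \<theta> x) = dens \<theta> x * (cutoff (gate \<theta> x) * (\<Sum>k<K. a k * score (\<theta> k) (x k)) +
      cutoff' (gate \<theta> x) * (4 / (b * K)) * (\<Sum>k<K. (a k *\<^sub>R (\<i> * cis (\<theta> k))) \<bullet> x k))"
proof -
  have "(\<Sum>k<K. a k * mass_Some' k \<theta> x) = (\<Sum>k<K. dens \<theta> x * cutoff (gate \<theta> x) * (a k * score (\<theta> k) (x k)) +
      dens \<theta> x * cutoff' (gate \<theta> x) * (4 / (b * K)) * ((a k *\<^sub>R (\<i> * cis (\<theta> k))) \<bullet> x k))"
    using x by (intro sum.cong refl) (simp add: mass_Some'_def dens'_eq algebra_simps)
  then show ?thesis
    by (simp add: sum.distrib sum_distrib_left sum_divide_distrib distrib_left mult_ac)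
qed

lemma abs_sum_mass_Some'_le:
  assumes x: "x \<in> cube"
  shows "\<bar>\<Sum>k<K. a k * mass_Some' k \<theta> x\<bar> \<le> dens \<theta> x * \<bar>\<Sum>k<K. a k * score (\<theta> k) (x k)\<bar> +
      b / 100 * (dens \<theta> x * \<bar>\<Sum>k<K. (a k *\<^sub>R (\<i> * cis (\<theta> k))) \<bullet> x k\<bar>)"
proof -
  have "\<bar>cutoff' (gate \<theta> x) * (4 / (b * K))\<bar> \<le> 4 * (4 / (b * K))"
    unfolding abs_mult using abs_cutoff'_le b_pos by (intro mult_mono) auto
  also have "\<dots> \<le> b / 100" using inverse_bK by simp
  finally have c': "\<bar>cutoff' (gate \<theta> x) * (4 / (b * K))\<bar> \<le> b / 100" .
  have c: "\<bar>cutoff (gate \<theta> x)\<bar> \<le> 1" using cutoff_nonneg cutoff_le_1 by simp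
  have "\<bar>\<Sum>k<K. a k * mass_Some' k \<theta> x\<bar> \<le> dens \<theta> x * (\<bar>cutoff (gate \<theta> x)\<bar> * \<bar>\<Sum>k<K. a k * score (\<theta> k) (x k)\<bar> +
      \<bar>cutoff' (gate \<theta> x) * (4 / (b * K))\<bar> * \<bar>\<Sum>k<K. (a k *\<^sub>R (\<i> * cis (\<theta> k))) \<bullet> x k\<bar>)"
    unfolding sum_mass_Some'_eq[OF x] abs_mult[of "dens _ _"] abs_of_nonneg[OF dens_nonneg[OF x]]
      abs_mult[symmetric]
    by (intro mult_left_mono abs_triangle_ineq dens_nonneg x)
  also have "\<dots> \<le> dens \<theta> x * (1 * \<bar>\<Sum>k<K. a k * score (\<theta> k) (x k)\<bar> +
      b / 100 * \<bar>\<Sum>k<K. (a k *\<^sub>R (\<i> * cis (\<theta> k))) \<bullet> x k\<bar>)"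
    by (intro mult_left_mono add_mono mult_right_mono c c' dens_nonneg x) auto
  finally show ?thesis by (simp add: algebra_simps)
qed

text \<open>The score part and the cutoff part are centred sums over independent blocks, so second
  moments bound their absolute means independently of \<open>K\<close>. The cube contributes at most
  \<open>2 * b + b / 100\<close>; \<open>None\<close> contributes at most as much again, since its
  derivative balances that of the cube.\<close>

lemma sum_abs_mass'_le:
  assumes a: "(\<Sum>k<K. (a k)\<^sup>2) \<le> 1"
  shows "(\<Sum>y\<in>points. \<bar>\<Sum>k<K. a k * mass' k \<theta> y\<bar>) \<le> 5 * b"
proof -
  have 1: "(\<Sum>x\<in>cube. dens \<theta> x * \<bar>\<Sum>k<K. a k * score (\<theta> k) (x k)\<bar>) \<le> 2 * b"
  proof (rule weighted_sum_abs_le)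
    have "(\<Sum>x\<in>cube. dens \<theta> x * (\<Sum>k<K. a k * score (\<theta> k) (x k))\<^sup>2) =
        (\<Sum>k<K. \<Sum>x\<in>signs. block (\<theta> k) x * (a k * score (\<theta> k) x)\<^sup>2)"
      by (rule dens_second_moment) (simp add: sum_block_score sum_distrib_left[symmetric] mult.left_commute[of _ "a _"])
    also have "\<dots> = (\<Sum>k<K. (a k)\<^sup>2 * (\<Sum>x\<in>signs. block (\<theta> k) x * (score (\<theta> k) x)\<^sup>2))"
      by (simp add: sum_distrib_left power_mult_distrib mult_ac)
    also have "\<dots> \<le> (\<Sum>k<K. (a k)\<^sup>2 * (2 * b)\<^sup>2)"
      by (intro sum_mono mult_left_mono sum_block_score_square) auto
    also have "\<dots> \<le> 1 * (2 * b)\<^sup>2"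
      unfolding sum_distrib_right[symmetric] using a by (intro mult_right_mono) auto
    finally show "(\<Sum>x\<in>cube. dens \<theta> x * (\<Sum>k<K. a k * score (\<theta> k) (x k))\<^sup>2) \<le> (2 * b)\<^sup>2" by simp
  qed (use b_pos dens_nonneg sum_dens in auto)
  have 2: "(\<Sum>x\<in>cube. dens \<theta> x * \<bar>\<Sum>k<K. (a k *\<^sub>R (\<i> * cis (\<theta> k))) \<bullet> x k\<bar>) \<le> 1"
  proof (rule weighted_sum_abs_le)
    have "(\<Sum>x\<in>cube. dens \<theta> x * (\<Sum>k<K. (a k *\<^sub>R (\<i> * cis (\<theta> k))) \<bullet> x k)\<^sup>2) \<le> (\<Sum>k<K. (norm (a k *\<^sub>R (\<i> * cis (\<theta> k))))\<^sup>2)"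
      using dens_variance[of \<theta> "\<lambda>k. a k *\<^sub>R (\<i> * cis (\<theta> k))"] cis_inner_i_cis by simp
    also have "\<dots> \<le> 1\<^sup>2" using a by (simp add: norm_i_cis)
    finally show "(\<Sum>x\<in>cube. dens \<theta> x * (\<Sum>k<K. (a k *\<^sub>R (\<i> * cis (\<theta> k))) \<bullet> x k)\<^sup>2) \<le> 1\<^sup>2" .
  qed (use dens_nonneg sum_dens in auto)
  have "(\<Sum>x\<in>cube. \<bar>\<Sum>k<K. a k * mass_Some' k \<theta> x\<bar>) \<le>
      (\<Sum>x\<in>cube. dens \<theta> x * \<bar>\<Sum>k<K. a k * score (\<theta> k) (x k)\<bar> +
        b / 100 * (dens \<theta> x * \<bar>\<Sum>k<K. (a k *\<^sub>R (\<i> * cis (\<theta> k))) \<bullet> x k\<bar>))"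
    by (intro sum_mono abs_sum_mass_Some'_le)
  also have "\<dots> \<le> 2 * b + b / 100 * 1"
    unfolding sum.distrib sum_distrib_left[symmetric]
    using b_pos by (intro add_mono mult_left_mono 1 2) auto
  finally have 3: "(\<Sum>x\<in>cube. \<bar>\<Sum>k<K. a k * mass_Some' k \<theta> x\<bar>) \<le> 2 * b + b / 100" by simp
  have "(\<Sum>k<K. a k * mass' k \<theta> None) = - (\<Sum>x\<in>cube. \<Sum>k<K. a k * mass_Some' k \<theta> x)"
    by (subst sum.swap) (simp add: mass'_def sum_distrib_left sum_negf)
  then have "\<bar>\<Sum>k<K. a k * mass' k \<theta> None\<bar> \<le> (\<Sum>x\<in>cube. \<bar>\<Sum>k<K. a k * mass_Some' k \<theta> x\<bar>)"
    by simp
  then show ?thesis using 3 b_pos by (simp add: sum_points mass'_def)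
qed

text \<open>The previous bound for a coordinate direction; it serves the boundedness hypothesis of
  the divergence theorem.\<close>

lemma abs_mass'_le:
  assumes y: "y \<in> points" and k: "k < K"
  shows "\<bar>mass' k \<theta> y\<bar> \<le> 5 * b"
proof -
  define a :: "nat \<Rightarrow> real" where "a l = (if l = k then 1 else 0)" for l
  have "(\<Sum>l<K. (a l)\<^sup>2) = (\<Sum>l<K. if l = k then 1 else 0)" by (intro sum.cong) (auto simp: a_def)
  then have a: "(\<Sum>l<K. (a l)\<^sup>2) \<le> 1" by simp
  have eq: "(\<Sum>l<K. a l * mass' l \<theta> z) = mass' k \<theta> z" for z
  proof -
    have "(\<Sum>l<K. a l * mass' l \<theta> z) = (\<Sum>l<K. if l = k then mass' l \<theta> z else 0)"
      by (intro sum.cong) (auto simp: a_def)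
    then show ?thesis using k by simp
  qed
  have "\<bar>mass' k \<theta> y\<bar> \<le> (\<Sum>z\<in>points. \<bar>mass' k \<theta> z\<bar>)"
    using y by (intro member_le_sum) auto
  also have "\<dots> \<le> 5 * b" using sum_abs_mass'_le[OF a, of \<theta>] by (simp add: eq)
  finally show ?thesis .
qed

text \<open>A pointwise bound, uniform over all directions \<open>a\<close> and so over all outputs
  of a learner, as the additive privacy loss requires. The price is a factor \<open>sqrt K\<close>,
  from comparing the sum of the absolute values of \<open>a\<close> with its Euclidean norm; it will
  only be multiplied by \<open>\<delta>\<close>.\<close>

definition bound :: "(nat \<Rightarrow> real) \<Rightarrow> (nat \<Rightarrow> complex) option \<Rightarrow> real" where
  "bound \<theta> y = (case y of None \<Rightarrow> 5 * b | Some x \<Rightarrow> dens \<theta> x * (4 * b * sqrt K))"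

lemma sum_bound: "(\<Sum>y\<in>points. bound \<theta> y) = 4 * b * sqrt K + 5 * b"
  by (simp add: sum_points bound_def sum_distrib_right[symmetric] sum_dens)

lemma abs_sum_mass'_le_bound:
  assumes a: "(\<Sum>k<K. (a k)\<^sup>2) \<le> 1" and y: "y \<in> points"
  shows "\<bar>\<Sum>k<K. a k * mass' k \<theta> y\<bar> \<le> bound \<theta> y"
proof (cases y)
  case None
  have "\<bar>\<Sum>k<K. a k * mass' k \<theta> y\<bar> \<le> (\<Sum>z\<in>points. \<bar>\<Sum>k<K. a k * mass' k \<theta> z\<bar>)"
    using y by (intro member_le_sum) auto
  then show ?thesis using sum_abs_mass'_le[OF a, of \<theta>] None by (simp add: bound_def)
next
  case (Some x)
  then have x: "x \<in> cube" using y by (auto simp: points_def)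
  have i: "\<bar>(\<i> * cis (\<theta> k)) \<bullet> x k\<bar> \<le> 3 / 2" if "k < K" for k
    using that x by (intro inner_signs_le cube_signs) (auto simp: norm_i_cis)
  have "\<bar>\<Sum>k<K. a k * score (\<theta> k) (x k)\<bar> \<le> (\<Sum>k<K. \<bar>a k\<bar> * (3 * b))"
  proof (rule order_trans[OF sum_abs], intro sum_mono)
    fix k assume k: "k \<in> {..<K}"
    have "\<bar>score (\<theta> k) (x k)\<bar> \<le> 2 * b * \<bar>(\<i> * cis (\<theta> k)) \<bullet> x k\<bar>"
      using k x by (intro abs_score_le cube_signs) auto
    also have "\<dots> \<le> 2 * b * (3 / 2)" using i k b_pos by (intro mult_left_mono) auto
    finally show "\<bar>a k * score (\<theta> k) (x k)\<bar> \<le> \<bar>a k\<bar> * (3 * b)"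
      by (simp add: abs_mult mult_left_mono)
  qed
  moreover have "\<bar>\<Sum>k<K. (a k *\<^sub>R (\<i> * cis (\<theta> k))) \<bullet> x k\<bar> \<le> (\<Sum>k<K. \<bar>a k\<bar> * (3 / 2))"
    unfolding inner_scaleR_left
    by (intro order_trans[OF sum_abs] sum_mono, subst abs_mult, intro mult_left_mono i) auto
  ultimately have "\<bar>\<Sum>k<K. a k * mass_Some' k \<theta> x\<bar> \<le> dens \<theta> x * (\<Sum>k<K. \<bar>a k\<bar> * (3 * b)) +
      b / 100 * (dens \<theta> x * (\<Sum>k<K. \<bar>a k\<bar> * (3 / 2)))"
    using b_pos dens_nonneg[OF x]
    by (intro order_trans[OF abs_sum_mass_Some'_le[OF x]] add_mono mult_left_mono) auto
  also have "\<dots> = dens \<theta> x * (b * (3 + 3 / 200) * (\<Sum>k<K. \<bar>a k\<bar>))"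
    by (simp only: sum_distrib_right[symmetric]) (simp add: algebra_simps)
  also have "\<dots> \<le> dens \<theta> x * (b * 4 * sqrt K)"
  proof (intro mult_left_mono mult_mono dens_nonneg x)
    have "(\<Sum>k<K. \<bar>a k\<bar>)\<^sup>2 \<le> (\<Sum>k<K. (1::real)\<^sup>2) * (\<Sum>k<K. \<bar>a k\<bar>\<^sup>2)"
      using Cauchy_Schwarz_ineq_sum[of "\<lambda>_. 1" "\<lambda>k. \<bar>a k\<bar>" "{..<K}"] by simp
    also have "\<dots> \<le> K * 1" using a by (simp add: mult_left_le)
    finally show "(\<Sum>k<K. \<bar>a k\<bar>) \<le> sqrt K" by (simp add: real_le_rsqrt)
  qed (use b_pos in \<open>auto intro: sum_nonneg\<close>)
  finally show ?thesis using Some by (simp add: mass'_def bound_def mult_ac)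
qed

section \<open>Differentiability, periodicity and measurability in the angles\<close>

lemma block_DERIV [derivative_intros]:
  "((\<lambda>t. block t x) has_real_derivative b * ((\<i> * cis t) \<bullet> x) / 4) (at t)"
  unfolding block_def inner_complex_def by (auto intro!: derivative_eq_intros)

lemma mass_Some_DERIV:
  assumes k: "k < K"
  shows "((\<lambda>t. mass_Some (\<theta>(k := t)) x) has_real_derivative mass_Some' k \<theta> x) (at (\<theta> k))"
proof -
  have "dens (\<theta>(k := t)) x = block t (x k) * (\<Prod>l\<in>{..<K} - {k}. block (\<theta> l) (x l))" for t
    using k by (simp add: dens_def prod.remove[of "{..<K}" k])
  moreover have "((\<lambda>t. block t (x k) * (\<Prod>l\<in>{..<K} - {k}. block (\<theta> l) (x l)))
      has_real_derivative dens' k \<theta> x) (at (\<theta> k))"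
    unfolding dens'_def by (rule DERIV_cmult_right[OF block_DERIV])
  ultimately have 1: "((\<lambda>t. dens (\<theta>(k := t)) x) has_real_derivative dens' k \<theta> x) (at (\<theta> k))"
    by simp
  have "gate (\<theta>(k := t)) x =
      (cis t \<bullet> x k + (\<Sum>l\<in>{..<K} - {k}. cis (\<theta> l) \<bullet> x l) - b * K / 2) * (4 / (b * K))" for t
    using k by (simp add: gate_def sum.remove[of "{..<K}" k])
  moreover have "((\<lambda>t. (cis t \<bullet> x k + (\<Sum>l\<in>{..<K} - {k}. cis (\<theta> l) \<bullet> x l) - b * K / 2) * (4 / (b * K)))
      has_real_derivative ((\<i> * cis (\<theta> k)) \<bullet> x k) * (4 / (b * K))) (at (\<theta> k))"
    unfolding inner_complex_def using b_pos K_pos by (auto intro!: derivative_eq_intros)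
  ultimately have 2: "((\<lambda>t. gate (\<theta>(k := t)) x) has_real_derivative
      ((\<i> * cis (\<theta> k)) \<bullet> x k) * (4 / (b * K))) (at (\<theta> k))"
    by simp
  show ?thesis
    unfolding mass_Some_def mass_Some'_def
    using DERIV_mult[OF 1 DERIV_chain2[OF DERIV_cutoff 2]] by (simp add: mult_ac)
qed

lemma mass_DERIV:
  assumes "k < K"
  shows "((\<lambda>t. mass (\<theta>(k := t)) y) has_real_derivative mass' k \<theta> y) (at (\<theta> k))"
  by (cases y) (auto simp: mass_def mass'_def intro!: mass_Some_DERIV assms derivative_eq_intros)

lemma mass_periodic: "mass (\<theta>(k := 2 * pi)) y = mass (\<theta>(k := 0)) y"
proof -
  have cis: "cis ((\<theta>(k := 2 * pi)) l) = cis ((\<theta>(k := 0)) l)" for l by simp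
  show ?thesis
    unfolding mass_def mass_Some_def dens_def block_def gate_def cis ..
qed

lemma block_measurable [measurable]: "(\<lambda>t. block t x) \<in> borel_measurable borel"
  and cis_inner_measurable [measurable]: "(\<lambda>t. cis t \<bullet> u) \<in> borel_measurable borel"
  and i_cis_inner_measurable [measurable]: "(\<lambda>t. (\<i> * cis t) \<bullet> u) \<in> borel_measurable borel"
  unfolding block_def inner_complex_def by (simp_all, measurable)

lemma mass_measurable: "(\<lambda>\<theta>. mass \<theta> y) \<in> borel_measurable (Pi\<^sub>M {..<K} (\<lambda>_. borel))"
proof -
  have "(\<lambda>\<theta>. mass_Some \<theta> x) \<in> borel_measurable (Pi\<^sub>M {..<K} (\<lambda>_. borel))" for x
    unfolding mass_Some_def dens_def gate_def by measurable
  then show ?thesis by (cases y) (auto simp: mass_def)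
qed

lemma mass'_measurable:
  assumes k: "k < K"
  shows "(\<lambda>\<theta>. mass' k \<theta> y) \<in> borel_measurable (Pi\<^sub>M {..<K} (\<lambda>_. borel))"
proof -
  have [measurable]: "(\<lambda>\<theta>. \<theta> k) \<in> Pi\<^sub>M {..<K} (\<lambda>_. borel) \<rightarrow>\<^sub>M (borel :: real measure)"
    using k by (intro measurable_component_singleton) auto
  have "(\<lambda>\<theta>. mass_Some' k \<theta> x) \<in> borel_measurable (Pi\<^sub>M {..<K} (\<lambda>_. borel))" for x
    unfolding mass_Some'_def dens_def dens'_def gate_def by measurable
  then show ?thesis by (cases y) (auto simp: mass'_def)
qed

section \<open>The fingerprinting inequality\<close>

text \<open>Lets the tangential components of an output serve as the coefficients \<open>a\<close>
  in the bounds on \<open>mass'\<close>.\<close>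

lemma sum_cis_i_cis_square_le:
  assumes "(\<Sum>k<K. (norm (u k))\<^sup>2) \<le> 1"
  shows "(\<Sum>k<K. (u k \<bullet> (\<i> * cis (\<theta> k)))\<^sup>2) \<le> 1"
proof -
  have "(u k \<bullet> (\<i> * cis (\<theta> k)))\<^sup>2 \<le> (norm (u k))\<^sup>2" for k
  proof -
    have "\<bar>u k \<bullet> (\<i> * cis (\<theta> k))\<bar> \<le> norm (u k)"
      using Cauchy_Schwarz_ineq2[of "u k" "\<i> * cis (\<theta> k)"] by (simp add: norm_i_cis)
    then show ?thesis by (metis abs_ge_zero power2_abs power_mono)
  qed
  then show ?thesis by (intro order_trans[OF sum_mono assms])
qed

text \<open>Otherwise the divergence of the field \<open>H\<close> would be at most the negative
  constant \<open>- (a - n * R)\<close> at all angles. Here \<open>R\<close> bounds the effect of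
  one example: \<open>10 * b\<close> is twice the total absolute derivative of the masses, and the
  rest is \<open>\<delta>\<close> times the sum of the pointwise bounds.\<close>

theorem private_correlation_le:
  fixes N :: "(nat \<Rightarrow> complex) option list \<Rightarrow> 'h measure" and P :: "'h measure"
    and v :: "'h \<Rightarrow> nat \<Rightarrow> complex"
  assumes prob: "\<And>ys. ys \<in> lists points \<Longrightarrow> prob_space (N ys)"
    and sets: "\<And>ys. ys \<in> lists points \<Longrightarrow> sets (N ys) = sets P"
    and v_meas: "\<And>k. (\<lambda>h. v h k) \<in> borel_measurable P"
    and v_norm: "\<And>h. (\<Sum>k<K. (norm (v h k))\<^sup>2) \<le> 1"
    and priv: "\<And>us z vs S. us \<in> lists points \<Longrightarrow> z \<in> points \<Longrightarrow> vs \<in> lists points \<Longrightarrow> S \<in> sets P \<Longrightarrow>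
      measure (N (us @ z # vs)) S \<le> exp \<epsilon> * measure (N (us @ vs)) S + \<delta>"
    and \<epsilon>: "\<epsilon> \<le> 1" and \<delta>: "\<delta> \<ge> 0"
    and acc: "\<And>\<theta>. a \<le> (\<Sum>X\<in>{..<n} \<rightarrow>\<^sub>E points. (\<Prod>i<n. mass \<theta> (X i)) *
      (\<integral>h. (\<Sum>k<K. v h k \<bullet> cis (\<theta> k)) \<partial>N (map X [0..<n])))"
  shows "a \<le> n * (10 * b + \<delta> * (4 * b * sqrt K + 5 * b))"
proof (rule ccontr)
  define R where "R = 10 * b + \<delta> * (4 * b * sqrt K + 5 * b)"
  assume "\<not> ?thesis"
  then have \<eta>: "a - n * R > 0" by (simp add: R_def)
  define data where "data = {..<n} \<rightarrow>\<^sub>E points"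
  have data_lists: "map X [0..<n] \<in> lists points" if "X \<in> data" for X
  proof -
    have "X i \<in> points" if "i < n" for i
      using PiE_mem[OF \<open>X \<in> data\<close>[unfolded data_def], of i] that by simp
    then show ?thesis by (auto simp: in_lists_conv_set)
  qed
  have v1: "norm (v h k) \<le> 1" if "k < K" for h k
  proof -
    have "(norm (v h k))\<^sup>2 \<le> (\<Sum>k<K. (norm (v h k))\<^sup>2)" using that by (intro member_le_sum) auto
    then have "(norm (v h k))\<^sup>2 \<le> 1\<^sup>2" using v_norm[of h] by simp
    then show ?thesis by (rule power2_le_imp_le) simp
  qed
  have v_int: "integrable (N ys) (\<lambda>h. v h k)" if "ys \<in> lists points" "k < K" for ys k
  proof -
    interpret prob_space "N ys" by (rule prob) fact
    show ?thesis
      using v1 that(2) v_meas sets[OF that(1)]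
      by (intro integrable_const_bound[of _ 1]) (auto cong: measurable_cong_sets)
  qed
  define W where "W X k = (\<integral>h. v h k \<partial>N (map X [0..<n]))" for X k
  have lin: "(\<integral>h. (\<Sum>k<K. c k * (v h k \<bullet> u k)) \<partial>N ys) = (\<Sum>k<K. c k * ((\<integral>h. v h k \<partial>N ys) \<bullet> u k))"
    "integrable (N ys) (\<lambda>h. \<Sum>k<K. c k * (v h k \<bullet> u k))"
    if "ys \<in> lists points" for ys c and u :: "nat \<Rightarrow> complex"
  proof -
    have int: "integrable (N ys) (\<lambda>h. c k * (v h k \<bullet> u k))" if "k \<in> {..<K}" for k
      using v_int[OF \<open>ys \<in> lists points\<close>, of k] that by simp
    show "integrable (N ys) (\<lambda>h. \<Sum>k<K. c k * (v h k \<bullet> u k))"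
      by (rule Bochner_Integration.integrable_sum[OF int])
    show "(\<integral>h. (\<Sum>k<K. c k * (v h k \<bullet> u k)) \<partial>N ys) = (\<Sum>k<K. c k * ((\<integral>h. v h k \<partial>N ys) \<bullet> u k))"
      using v_int[OF that] by (subst Bochner_Integration.integral_sum[OF int]) (auto intro!: sum.cong)
  qed
  define weight where "weight \<theta> X = (\<Prod>i<n. mass \<theta> (X i))" for \<theta> X
  define rest where "rest i \<theta> X = (\<Prod>j\<in>{..<n} - {i}. mass \<theta> (X j))" for i \<theta> and X :: "nat \<Rightarrow> (nat \<Rightarrow> complex) option"
  define weight' where "weight' k \<theta> X = (\<Sum>i<n. mass' k \<theta> (X i) * rest i \<theta> X)" for k \<theta> X
  define \<tau> where "\<tau> \<theta> k = \<i> * cis (\<theta> k)" for \<theta> :: "nat \<Rightarrow> real" and k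
  \<comment> \<open>\<open>H k\<close> is the expected component of the output along
    \<open>\<tau> \<theta> k\<close>. Its partial derivative is \<open>G k\<close>, where the minus
    sign arises because the derivative of \<open>\<i> * cis t\<close> is
    \<open>- cis t\<close>.\<close>
  define H where "H k \<theta> = (\<Sum>X\<in>data. weight \<theta> X * (W X k \<bullet> \<tau> \<theta> k))" for k \<theta>
  define G where "G k \<theta> = (\<Sum>X\<in>data. weight' k \<theta> X * (W X k \<bullet> \<tau> \<theta> k) - weight \<theta> X * (W X k \<bullet> cis (\<theta> k)))" for k \<theta>
  \<comment> \<open>The sample with \<open>y\<close> in position \<open>i\<close> is compared with
    the sample lacking that position, so that the output distribution on the right is independent of
    \<open>y\<close>.\<close>
  have swap: "(\<integral>h. T h \<partial>N (map (X(i := y)) [0..<n])) \<le> (\<integral>h. T h \<partial>N (map X ([0..<i] @ [Suc i..<n]))) +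
      2 * (\<integral>h. \<bar>T h\<bar> \<partial>N (map X ([0..<i] @ [Suc i..<n]))) + \<delta> * B"
    if i: "i < n" and X: "X \<in> ({..<n} - {i}) \<rightarrow>\<^sub>E points" and y: "y \<in> points"
      and T: "T \<in> borel_measurable P" "\<And>h. \<bar>T h\<bar> \<le> B" for i X y T B
  proof -
    have us: "map X [0..<i] \<in> lists points" and vs: "map X [Suc i..<n] \<in> lists points"
    proof -
      have "X j \<in> points" if "j < n" "j \<noteq> i" for j
        using PiE_mem[OF X, of j] that by simp
      then show "map X [0..<i] \<in> lists points" "map X [Suc i..<n] \<in> lists points"
        using i by (auto simp: in_lists_conv_set)
    qed
    have all: "map X [0..<i] @ y # map X [Suc i..<n] \<in> lists points"
      "map X [0..<i] @ map X [Suc i..<n] \<in> lists points" using us vs y by auto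
    show ?thesis
      unfolding map_upt_update[OF i] map_append
      by (rule integral_diff_le_of_private[where P = P and \<epsilon> = \<epsilon>, OF prob[OF all(1)] prob[OF all(2)] sets[OF all(1)] sets[OF all(2)]])
        (fact priv[OF us y vs] T \<epsilon> \<delta>)+
  qed
  have sum_swap: "(\<Sum>X\<in>data. rest i \<theta> X * (\<Sum>k<K. mass' k \<theta> (X i) * (W X k \<bullet> \<tau> \<theta> k))) \<le> R" if i: "i < n" for i \<theta>
  proof -
    define J where "J = {..<n} - {i}"
    define T where "T y h = (\<Sum>k<K. mass' k \<theta> y * (v h k \<bullet> \<tau> \<theta> k))" for y h
    have T_meas: "T y \<in> borel_measurable P" for y
      unfolding T_def using v_meas by measurable
    have a: "(\<Sum>k<K. (v h k \<bullet> \<tau> \<theta> k)\<^sup>2) \<le> 1" for h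
      unfolding \<tau>_def by (intro sum_cis_i_cis_square_le v_norm)
    have T_eq: "T y h = (\<Sum>k<K. (v h k \<bullet> \<tau> \<theta> k) * mass' k \<theta> y)" for y h
      by (simp add: T_def mult.commute)
    have T_bound: "\<bar>T y h\<bar> \<le> bound \<theta> y" if "y \<in> points" for y h
      unfolding T_eq by (intro abs_sum_mass'_le_bound a that)
    have T_abs: "(\<Sum>y\<in>points. \<bar>T y h\<bar>) \<le> 5 * b" for h
      unfolding T_eq by (intro sum_abs_mass'_le a)
    have T_zero: "(\<Sum>y\<in>points. T y h) = 0" for h
      unfolding T_def by (subst sum.swap) (simp add: sum_distrib_right[symmetric] sum_mass')
    have inner: "(\<Sum>y\<in>points. \<Sum>k<K. mass' k \<theta> y * (W (X(i := y)) k \<bullet> \<tau> \<theta> k)) \<le> R"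
      if X: "X \<in> J \<rightarrow>\<^sub>E points" for X
    proof -
      define ys where "ys = map X ([0..<i] @ [Suc i..<n])"
      let ?N = "N ys"
      have ys: "ys \<in> lists points"
      proof -
        have "X j \<in> points" if "j < n" "j \<noteq> i" for j
          using PiE_mem[OF X, of j] that by (simp add: J_def)
        then show ?thesis using i by (auto simp: ys_def in_lists_conv_set)
      qed
      interpret prob_space ?N by (rule prob[OF ys])
      have int: "integrable ?N (T y)" for y
        unfolding T_def using ys by (rule lin(2))
      have int_abs: "integrable ?N (\<lambda>h. \<bar>T y h\<bar>)" for y
        using int by (rule integrable_abs)
      have "(\<Sum>y\<in>points. \<Sum>k<K. mass' k \<theta> y * (W (X(i := y)) k \<bullet> \<tau> \<theta> k)) =
          (\<Sum>y\<in>points. \<integral>h. T y h \<partial>N (map (X(i := y)) [0..<n]))"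
      proof (intro sum.cong refl)
        fix y assume y: "y \<in> points"
        have "X(i := y) \<in> data" using X y i by (auto simp: J_def data_def PiE_def extensional_def)
        then show "(\<Sum>k<K. mass' k \<theta> y * (W (X(i := y)) k \<bullet> \<tau> \<theta> k)) = (\<integral>h. T y h \<partial>N (map (X(i := y)) [0..<n]))"
          unfolding T_def W_def by (intro lin(1)[symmetric] data_lists)
      qed
      also have "\<dots> \<le> (\<Sum>y\<in>points. (\<integral>h. T y h \<partial>?N) + 2 * (\<integral>h. \<bar>T y h\<bar> \<partial>?N) + \<delta> * bound \<theta> y)"
        using X i unfolding ys_def by (intro sum_mono swap T_meas T_bound) (auto simp: J_def)
      also have "\<dots> = (\<integral>h. (\<Sum>y\<in>points. T y h) \<partial>?N) + 2 * (\<integral>h. (\<Sum>y\<in>points. \<bar>T y h\<bar>) \<partial>?N) + \<delta> * (\<Sum>y\<in>points. bound \<theta> y)"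
        using int int_abs by (simp add: sum.distrib sum_distrib_left)
      \<comment> \<open>The signed terms cancel: they are integrals against one common measure, and
        the derivatives of the masses sum to zero.\<close>
      also have "\<dots> \<le> 0 + 2 * (\<integral>h. 5 * b \<partial>?N) + \<delta> * (4 * b * sqrt K + 5 * b)"
        unfolding T_zero sum_bound
        using int_abs T_abs b_pos \<delta> by (intro add_mono mult_left_mono integral_mono) auto
      also have "\<dots> = R" by (simp add: R_def prob_space)
      finally show ?thesis .
    qed
    have rest_upd: "rest i \<theta> (X(i := y)) = (\<Prod>j\<in>J. mass \<theta> (X j))" for X y
      unfolding rest_def J_def by (intro prod.cong) auto
    \<comment> \<open>The weight \<open>rest i\<close> does not involve the example at
      \<open>i\<close>, so that example can be summed out first and the bound averaged over the
      others.\<close>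
    have "data = (insert i J \<rightarrow>\<^sub>E points)" "i \<notin> J" using i by (auto simp: data_def J_def insert_absorb)
    then have "(\<Sum>X\<in>data. rest i \<theta> X * (\<Sum>k<K. mass' k \<theta> (X i) * (W X k \<bullet> \<tau> \<theta> k))) =
        (\<Sum>y\<in>points. \<Sum>X\<in>J \<rightarrow>\<^sub>E points. (\<Prod>j\<in>J. mass \<theta> (X j)) * (\<Sum>k<K. mass' k \<theta> y * (W (X(i := y)) k \<bullet> \<tau> \<theta> k)))"
      by (simp add: sum_PiE_insert rest_upd)
    also have "\<dots> = (\<Sum>X\<in>J \<rightarrow>\<^sub>E points. (\<Prod>j\<in>J. mass \<theta> (X j)) *
        (\<Sum>y\<in>points. \<Sum>k<K. mass' k \<theta> y * (W (X(i := y)) k \<bullet> \<tau> \<theta> k)))"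
      by (subst sum.swap) (simp add: sum_distrib_left)
    also have "\<dots> \<le> (\<Sum>X\<in>J \<rightarrow>\<^sub>E points. (\<Prod>j\<in>J. mass \<theta> (X j)) * R)"
      by (intro sum_mono mult_left_mono inner prod_nonneg) (auto intro: mass_nonneg)
    also have "\<dots> = (\<Prod>j\<in>J. \<Sum>y\<in>points. mass \<theta> y) * R"
      by (subst prod_sum_PiE) (auto simp: J_def sum_distrib_right)
    also have "\<dots> = R" by (simp add: sum_mass)
    finally show ?thesis .
  qed
  have neg: "(\<Sum>k<K. G k \<theta>) \<le> - (a - n * R)" for \<theta>
  proof -
    have "(\<Sum>k<K. \<Sum>X\<in>data. weight' k \<theta> X * (W X k \<bullet> \<tau> \<theta> k)) =
        (\<Sum>X\<in>data. \<Sum>k<K. \<Sum>i<n. rest i \<theta> X * (mass' k \<theta> (X i) * (W X k \<bullet> \<tau> \<theta> k)))"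
      by (subst sum.swap) (intro sum.cong refl, simp add: weight'_def sum_distrib_right, simp add: mult_ac)
    also have "\<dots> = (\<Sum>X\<in>data. \<Sum>i<n. rest i \<theta> X * (\<Sum>k<K. mass' k \<theta> (X i) * (W X k \<bullet> \<tau> \<theta> k)))"
      by (rule sum.cong[OF refl], subst sum.swap) (simp add: sum_distrib_left)
    also have "\<dots> = (\<Sum>i<n. \<Sum>X\<in>data. rest i \<theta> X * (\<Sum>k<K. mass' k \<theta> (X i) * (W X k \<bullet> \<tau> \<theta> k)))"
      by (rule sum.swap)
    also have "\<dots> \<le> (\<Sum>i<n. R)" by (intro sum_mono sum_swap) auto
    finally have 1: "(\<Sum>k<K. \<Sum>X\<in>data. weight' k \<theta> X * (W X k \<bullet> \<tau> \<theta> k)) \<le> n * R" by simp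
    have "(\<Sum>k<K. \<Sum>X\<in>data. weight \<theta> X * (W X k \<bullet> cis (\<theta> k))) =
        (\<Sum>X\<in>data. weight \<theta> X * (\<Sum>k<K. W X k \<bullet> cis (\<theta> k)))"
      by (subst sum.swap) (simp add: sum_distrib_left)
    also have "\<dots> = (\<Sum>X\<in>data. weight \<theta> X * (\<integral>h. (\<Sum>k<K. v h k \<bullet> cis (\<theta> k)) \<partial>N (map X [0..<n])))"
      using lin(1)[OF data_lists, of _ "\<lambda>_. 1"] by (simp add: W_def)
    also have "\<dots> \<ge> a" using acc[of \<theta>] by (simp add: weight_def data_def)
    finally show ?thesis using 1 by (simp add: G_def sum_subtractf)
  qed
  have deriv: "((\<lambda>t. H k (\<theta>(k := t))) has_real_derivative G k \<theta>) (at (\<theta> k))" if k: "k < K" for k \<theta>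
  proof -
    have w: "((\<lambda>t. weight (\<theta>(k := t)) X) has_real_derivative weight' k \<theta> X) (at (\<theta> k))" for X
      unfolding weight_def weight'_def rest_def
      using has_field_derivative_prod[of "{..<n}" "\<lambda>i t. mass (\<theta>(k := t)) (X i)" "\<lambda>i. mass' k \<theta> (X i)" "\<theta> k"]
        mass_DERIV[OF k] by simp
    have c: "((\<lambda>t. W X k \<bullet> \<tau> (\<theta>(k := t)) k) has_real_derivative - (W X k \<bullet> cis (\<theta> k))) (at (\<theta> k))" for X
      unfolding \<tau>_def inner_complex_def by (auto intro!: derivative_eq_intros)
    show ?thesis
      unfolding H_def G_def
      by (intro DERIV_sum) (use DERIV_mult[OF w c] in \<open>simp add: mult_ac\<close>)
  qed
  have periodic: "H k (\<theta>(k := 2 * pi)) = H k (\<theta>(k := 0))" for k \<theta>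
    by (simp add: H_def weight_def mass_periodic \<tau>_def)
  have meas: "G k \<in> borel_measurable (Pi\<^sub>M {..<K} (\<lambda>_. borel))" if k: "k < K" for k
  proof -
    note [measurable] = mass_measurable mass'_measurable[OF k]
    have [measurable]: "(\<lambda>\<theta>. \<theta> k) \<in> Pi\<^sub>M {..<K} (\<lambda>_. borel) \<rightarrow>\<^sub>M (borel :: real measure)"
      using k by (intro measurable_component_singleton) auto
    have 1: "(\<lambda>\<theta>. u \<bullet> \<tau> \<theta> k) \<in> borel_measurable (Pi\<^sub>M {..<K} (\<lambda>_. borel))" for u
      unfolding \<tau>_def inner_commute[of u] by measurable
    have 2: "(\<lambda>\<theta>. u \<bullet> cis (\<theta> k)) \<in> borel_measurable (Pi\<^sub>M {..<K} (\<lambda>_. borel))" for u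
      unfolding inner_commute[of u] by measurable
    note [measurable] = 1 2
    show ?thesis
      unfolding G_def weight_def weight'_def rest_def by measurable
  qed
  \<comment> \<open>A crude bound is enough here, as it only provides integrability on the
    torus.\<close>
  have bounded: "\<bar>G k \<theta>\<bar> \<le> (\<Sum>X\<in>data. (n * (5 * b) + 1) * norm (W X k))" if k: "k < K" for k \<theta>
    unfolding G_def
  proof (rule order_trans[OF sum_abs], intro sum_mono)
    fix X assume X: "X \<in> data"
    have in_points: "X i \<in> points" if "i < n" for i using X that by (auto simp: data_def)
    have w: "\<bar>weight \<theta> X\<bar> \<le> 1"
      using in_points mass_nonneg mass_le_1 by (auto simp: weight_def abs_prod intro!: prod_le_1)
    have r: "\<bar>rest i \<theta> X\<bar> \<le> 1" for i
      using in_points mass_nonneg mass_le_1 by (auto simp: rest_def abs_prod intro!: prod_le_1)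
    have "\<bar>weight' k \<theta> X\<bar> \<le> (\<Sum>i<n. 5 * b * 1)"
      unfolding weight'_def
    proof (rule order_trans[OF sum_abs], intro sum_mono)
      fix i assume "i \<in> {..<n}"
      then show "\<bar>mass' k \<theta> (X i) * rest i \<theta> X\<bar> \<le> 5 * b * 1"
        unfolding abs_mult using b_pos by (intro mult_mono abs_mass'_le in_points k r) auto
    qed
    then have w': "\<bar>weight' k \<theta> X\<bar> \<le> n * (5 * b)" by simp
    have cs: "\<bar>W X k \<bullet> \<tau> \<theta> k\<bar> \<le> norm (W X k)" "\<bar>W X k \<bullet> cis (\<theta> k)\<bar> \<le> norm (W X k)"
      using Cauchy_Schwarz_ineq2[of "W X k" "\<tau> \<theta> k"] Cauchy_Schwarz_ineq2[of "W X k" "cis (\<theta> k)"]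
      by (simp_all add: \<tau>_def norm_i_cis)
    have "\<bar>weight' k \<theta> X * (W X k \<bullet> \<tau> \<theta> k) - weight \<theta> X * (W X k \<bullet> cis (\<theta> k))\<bar> \<le>
        \<bar>weight' k \<theta> X\<bar> * \<bar>W X k \<bullet> \<tau> \<theta> k\<bar> + \<bar>weight \<theta> X\<bar> * \<bar>W X k \<bullet> cis (\<theta> k)\<bar>"
      unfolding abs_mult[symmetric] by (rule abs_triangle_ineq4)
    also have "\<dots> \<le> (n * (5 * b)) * norm (W X k) + 1 * norm (W X k)"
      using w w' cs b_pos by (intro add_mono mult_mono) auto
    finally show "\<bar>weight' k \<theta> X * (W X k \<bullet> \<tau> \<theta> k) - weight \<theta> X * (W X k \<bullet> cis (\<theta> k))\<bar> \<le>
        (n * (5 * b) + 1) * norm (W X k)" by (simp add: algebra_simps)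
  qed
  show False
    by (rule torus_divergence_not_negative[of "{..<K}" H G, OF finite_lessThan deriv periodic meas bounded neg \<eta>])
      simp_all
qed

section \<open>From few errors to correlation with the hidden parameter\<close>

text \<open>If the correlation were small, three rare events would cover the cube:
  \<open>E1\<close>, errors where the gate is fully open and \<open>mass\<close> equals
  \<open>dens\<close>; \<open>E2\<close>, deviations that can keep the gate from opening fully;
  \<open>E3\<close>, deviations of the product with \<open>u\<close> by at least 2 from its mean.
  Their probabilities are at most \<open>1 / 36\<close>, \<open>1 / 100\<close> and
  \<open>1 / 4\<close>, the last two by Chebyshev.\<close>

lemma correlation_of_mostly_correct:
  assumes u: "(\<Sum>k<K. (norm (u k))\<^sup>2) \<le> 1"
    and Err: "(\<Sum>y\<in>{y \<in> points. y \<in> Err}. mass \<theta> y) \<le> 1 / 36"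
    and margin: "\<And>x. x \<in> cube \<Longrightarrow> Some x \<notin> Err \<Longrightarrow> 15 / 100 * (b * sqrt K) \<le> (\<Sum>k<K. u k \<bullet> x k)"
  shows "sqrt K / 10 \<le> (\<Sum>k<K. u k \<bullet> cis (\<theta> k))"
proof -
  define c where "c = (\<Sum>k<K. cis (\<theta> k) \<bullet> u k)"
  have bK: "b * K > 0" using b_pos K_pos by simp
  have "15 / 100 * (b * sqrt K) - 2 \<le> b * c"
  proof (rule ccontr)
    assume neg: "\<not> ?thesis"
    define f where "f x = (\<Sum>k<K. u k \<bullet> x k) - b * c" for x
    define g where "g x = (\<Sum>k<K. cis (\<theta> k) \<bullet> x k) - b * K" for x
    define E1 where "E1 = {x \<in> cube. Some x \<in> Err \<and> cutoff (gate \<theta> x) = 1}"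
    define E2 where "E2 = {x \<in> cube. b * K / 4 \<le> \<bar>g x\<bar>}"
    define E3 where "E3 = {x \<in> cube. 2 \<le> \<bar>f x\<bar>}"
    have "(\<Sum>x\<in>cube. dens \<theta> x * (f x)\<^sup>2) \<le> 1"
      unfolding f_def c_def by (rule order_trans[OF dens_variance u])
    then have 3: "(\<Sum>x\<in>E3. dens \<theta> x) \<le> 1 / 2\<^sup>2"
      unfolding E3_def by (intro weighted_sum_Chebyshev) (auto intro: dens_nonneg)
    have "(\<Sum>x\<in>cube. dens \<theta> x * (g x)\<^sup>2) \<le> K"
      using dens_variance[of \<theta> "\<lambda>k. cis (\<theta> k)"] by (simp add: g_def power2_norm_eq_inner[symmetric])
    then have "(\<Sum>x\<in>E2. dens \<theta> x) \<le> K / (b * K / 4)\<^sup>2"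
      unfolding E2_def using bK by (intro weighted_sum_Chebyshev) (auto intro: dens_nonneg)
    also have "K / (b * K / 4)\<^sup>2 = 16 / (b * (b * K))"
      using b_pos K_pos by (simp add: power2_eq_square field_simps)
    also have "\<dots> \<le> 1 / 100"
      using b2K by (simp add: field_simps)
    finally have 2: "(\<Sum>x\<in>E2. dens \<theta> x) \<le> 1 / 100" .
    have "(\<Sum>x\<in>E1. dens \<theta> x) = (\<Sum>y\<in>Some ` E1. mass \<theta> y)"
      by (subst sum.reindex) (auto simp: E1_def mass_def mass_Some_def)
    also have "\<dots> \<le> (\<Sum>y\<in>{y \<in> points. y \<in> Err}. mass \<theta> y)"
      by (intro sum_mono2) (auto simp: E1_def points_def intro: mass_nonneg)
    finally have 1: "(\<Sum>x\<in>E1. dens \<theta> x) \<le> 1 / 36" using Err by simp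
    have un: "(\<Sum>x\<in>A \<union> B. dens \<theta> x) \<le> (\<Sum>x\<in>A. dens \<theta> x) + (\<Sum>x\<in>B. dens \<theta> x)"
      if "A \<subseteq> cube" "B \<subseteq> cube" for A B
    proof -
      have "0 \<le> (\<Sum>x\<in>A \<inter> B. dens \<theta> x)" using that by (intro sum_nonneg dens_nonneg) auto
      then show ?thesis using that finite_subset[OF _ finite_cube] by (subst sum_Un) auto
    qed
    have "cube \<subseteq> E1 \<union> E2 \<union> E3"
    proof
      fix x assume x: "x \<in> cube"
      show "x \<in> E1 \<union> E2 \<union> E3"
      proof (rule ccontr)
        assume n: "x \<notin> E1 \<union> E2 \<union> E3"
        have "\<bar>g x\<bar> < b * K / 4" using n x by (auto simp: E2_def)
        then have "b * K / 4 < (\<Sum>k<K. cis (\<theta> k) \<bullet> x k) - b * K / 2" unfolding g_def by linarith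
        then have "gate \<theta> x \<ge> 1" using bK by (simp add: gate_def field_simps)
        then have "Some x \<notin> Err" using n x by (auto simp: E1_def cutoff_eq_1)
        then have "2 \<le> f x" using margin[OF x] neg by (simp add: f_def)
        then show False using n x by (simp add: E3_def)
      qed
    qed
    then have "1 \<le> (\<Sum>x\<in>E1 \<union> E2 \<union> E3. dens \<theta> x)"
      unfolding sum_dens[of \<theta>, symmetric]
      by (intro sum_mono2) (auto simp: E1_def E2_def E3_def intro: dens_nonneg)
    also have "\<dots> \<le> (\<Sum>x\<in>E1. dens \<theta> x) + (\<Sum>x\<in>E2. dens \<theta> x) + (\<Sum>x\<in>E3. dens \<theta> x)"
      by (intro order_trans[OF un] add_mono un order.refl) (auto simp: E1_def E2_def E3_def)
    finally show False using 1 2 3 by (simp add: power2_eq_square)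
  qed
  \<comment> \<open>The loss 2 is at most \<open>5 / 100 * (b * sqrt K)\<close> by
    \<open>b_K\<close>, and \<open>15 / 100 - 5 / 100 = 1 / 10\<close>.\<close>
  then have "b * (sqrt K / 10) \<le> b * c" using b_K by simp
  then show ?thesis using b_pos by (simp add: c_def inner_commute)
qed

end

section \<open>Embedding into the unit ball\<close>

text \<open>The bound \<open>9 * \<gamma> <= b\<close> keeps the encoded examples in the ball of
  radius \<open>1 / 2\<close>, leaving room for perturbations. The strict inequality
  \<open>2 * K < d\<close> reserves the last coordinate for the extra example.\<close>

locale embedded_torus_family = torus_family +
  fixes \<gamma> :: real and d :: nat
  assumes \<gamma>_pos: "\<gamma> > 0" and \<gamma>_le: "\<gamma> \<le> 1 / 36" and \<gamma>_b: "9 * \<gamma> \<le> b" and d_gt: "2 * K < d"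
begin

text \<open>Chosen so that the correlation \<open>b * K / 2\<close> at which the gate opens is
  scaled to \<open>3 / 2 * \<gamma> * sqrt K\<close>, above \<open>\<gamma>\<close> times the norm
  \<open>sqrt (2 * K)\<close> of the teacher.\<close>

definition radius :: real where
  "radius = 3 * \<gamma> / (b * sqrt K)"

definition place :: "(nat \<Rightarrow> complex) \<Rightarrow> nat \<Rightarrow> real" where
  "place x j = (if j < 2 * K then if even j then Re (x (j div 2)) else Im (x (j div 2)) else 0)"

text \<open>Sign vectors are reflected because all labels are -1: a normal vector classifies an
  example correctly when its correlation with the sign vector is positive.\<close>

definition encode :: "(nat \<Rightarrow> complex) option \<Rightarrow> (nat \<Rightarrow> real) \<times> int" where
  "encode y = ((\<lambda>j\<in>{..<d}. case y of None \<Rightarrow> if j = d - 1 then - (1 / 2) else 0 | Some x \<Rightarrow> - radius * place x j), -1)"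

text \<open>The last coordinate gives the teacher its margin on the extra example.\<close>

definition teacher :: "(nat \<Rightarrow> real) \<Rightarrow> nat \<Rightarrow> real" where
  "teacher \<theta> = (\<lambda>j\<in>{..<d}. if j = d - 1 then sqrt K else place (\<lambda>k. cis (\<theta> k)) j)"

definition example_distribution :: "(nat \<Rightarrow> real) \<Rightarrow> ((nat \<Rightarrow> real) \<times> int) measure" where
  "example_distribution \<theta> = distr (point_measure points (\<lambda>y. ennreal (mass \<theta> y))) (example_space d) encode"

lemma radius_pos: "radius > 0"
  using \<gamma>_pos b_pos K_pos by (simp add: radius_def)

lemma radius_b: "radius * (b * sqrt K) = 3 * \<gamma>"
  using b_pos K_pos by (simp add: radius_def)

lemma sum_place: "(\<Sum>j<d. w j * place x j) = (\<Sum>k<K. Complex (w (2 * k)) (w (2 * k + 1)) \<bullet> x k)"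
proof -
  have "(\<Sum>j<d. w j * place x j) = (\<Sum>j<2 * K. w j * place x j)"
    using d_gt by (intro sum.mono_neutral_right) (auto simp: place_def)
  also have "\<dots> = (\<Sum>k<K. Complex (w (2 * k)) (w (2 * k + 1)) \<bullet> x k)"
    unfolding sum_lessThan_double by (intro sum.cong) (auto simp: place_def inner_complex_def)
  finally show ?thesis .
qed

lemma sum_place_square: "(\<Sum>j<d. (place x j)\<^sup>2) = (\<Sum>k<K. (norm (x k))\<^sup>2)"
proof -
  have "(\<Sum>j<d. (place x j)\<^sup>2) = (\<Sum>j<d. place x j * place x j)"
    by (simp add: power2_eq_square)
  also have "\<dots> = (\<Sum>k<K. (norm (x k))\<^sup>2)"
    unfolding sum_place by (intro sum.cong) (auto simp: place_def inner_complex_def cmod_power2 simp flip: power2_eq_square)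
  finally show ?thesis .
qed

lemma L2_set_encode_le:
  assumes "y \<in> points"
  shows "L2_set (fst (encode y)) {..<d} \<le> 1 / 2"
proof (rule power2_le_imp_le)
  show "(L2_set (fst (encode y)) {..<d})\<^sup>2 \<le> (1 / 2)\<^sup>2"
  proof (cases y)
    case None
    have "(\<Sum>j<d. (fst (encode y) j)\<^sup>2) = (\<Sum>j<d. if j = d - 1 then (1 / 2)\<^sup>2 else 0)"
      using None by (intro sum.cong) (auto simp: encode_def)
    then show ?thesis using d_gt by (simp add: L2_set_def)
  next
    case (Some x)
    then have x: "x \<in> cube" using assms by (auto simp: points_def)
    have "(\<Sum>j<d. (fst (encode y) j)\<^sup>2) = radius\<^sup>2 * (\<Sum>j<d. (place x j)\<^sup>2)"
      unfolding sum_distrib_left using Some by (intro sum.cong) (auto simp: encode_def power_mult_distrib)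
    also have "\<dots> = radius\<^sup>2 * (2 * K)"
      using x by (simp add: sum_place_square norm_signs cube_signs)
    also have "\<dots> = 2 * (3 * \<gamma> / b)\<^sup>2"
      using K_pos b_pos by (simp add: radius_def power2_eq_square field_simps)
    also have "\<dots> \<le> 2 * (1 / 3)\<^sup>2"
      using \<gamma>_b \<gamma>_pos b_pos by (intro mult_left_mono power_mono) (auto simp: field_simps)
    also have "\<dots> \<le> (1 / 2)\<^sup>2" by (simp add: power2_eq_square)
    finally show ?thesis by (simp add: L2_set_def sum_nonneg)
  qed
qed simp

lemma encode_in_space: "encode \<in> points \<rightarrow> space (example_space d)"
proof
  fix y assume "y \<in> points"
  from L2_set_encode_le[OF this] show "encode y \<in> space (example_space d)"
    by (auto simp: space_example_space unit_ball_def encode_def)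
qed

lemma snd_encode: "snd (encode y) = -1"
  by (simp add: encode_def)

lemma sum_encode_Some:
  "(\<Sum>j<d. w j * fst (encode (Some x)) j) = - radius * (\<Sum>k<K. Complex (w (2 * k)) (w (2 * k + 1)) \<bullet> x k)"
  unfolding sum_place[symmetric] sum_distrib_left by (intro sum.cong) (auto simp: encode_def)

lemma sum_encode_None: "(\<Sum>j<d. w j * fst (encode None) j) = - (w (d - 1) / 2)"
proof -
  have "(\<Sum>j<d. w j * fst (encode None) j) = (\<Sum>j<d. if j = d - 1 then - (w j / 2) else 0)"
    by (intro sum.cong) (auto simp: encode_def)
  then show ?thesis using d_gt by simp
qed

section \<open>The teacher and realizability\<close>

lemma L2_set_teacher: "L2_set (teacher \<theta>) {..<d} = sqrt (2 * K)"
proof -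
  have "(\<Sum>j<d. (teacher \<theta> j)\<^sup>2) = (\<Sum>j<d. (place (\<lambda>k. cis (\<theta> k)) j)\<^sup>2 + (if j = d - 1 then real K else 0))"
    using d_gt by (intro sum.cong) (auto simp: teacher_def place_def)
  also have "\<dots> = 2 * K"
    using d_gt by (simp add: sum.distrib sum_place_square)
  finally show ?thesis by (simp add: L2_set_def)
qed

text \<open>On the cube, positive mass forces an open gate and hence a correlation above
  \<open>b * K / 2\<close>. The extra example has the margin \<open>sqrt K / 2\<close>, which is
  ample since \<open>\<gamma> <= 1 / 36\<close>.\<close>

lemma teacher_margin:
  assumes y: "y \<in> points" and mass: "mass \<theta> y > 0"
  shows "(\<Sum>j<d. teacher \<theta> j * fst (encode y) j) < - (\<gamma> * sqrt (2 * K))"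
proof -
  have "sqrt (2 * K) \<le> sqrt ((3 / 2)\<^sup>2 * K)"
    by (intro real_sqrt_le_mono mult_right_mono) (auto simp: power2_eq_square)
  also have "\<dots> = 3 / 2 * sqrt K" by (simp add: real_sqrt_mult)
  finally have s: "\<gamma> * sqrt (2 * K) \<le> \<gamma> * (3 / 2 * sqrt K)"
    using \<gamma>_pos by (intro mult_left_mono) auto
  show ?thesis
  proof (cases y)
    case None
    have "\<gamma> * (3 / 2 * sqrt K) \<le> 1 / 36 * (3 / 2 * sqrt K)" using \<gamma>_le by (intro mult_right_mono) auto
    also have "\<dots> < sqrt K / 2" using K_pos by simp
    finally show ?thesis using s None d_gt by (simp add: sum_encode_None teacher_def)
  next
    case (Some x)
    then have x: "x \<in> cube" using y by (auto simp: points_def)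
    have "cutoff (gate \<theta> x) > 0"
      using mass Some dens_nonneg[OF x, of \<theta>] by (auto simp: mass_def mass_Some_def zero_less_mult_iff)
    then have "gate \<theta> x > 0" by (rule cutoff_pos_imp)
    then have corr: "b * K / 2 < (\<Sum>k<K. cis (\<theta> k) \<bullet> x k)"
      using zero_less_mult_pos2[of "(\<Sum>k<K. cis (\<theta> k) \<bullet> x k) - b * K / 2" "4 / (b * K)"] b_pos K_pos
      by (simp add: gate_def)
    have "Complex (teacher \<theta> (2 * k)) (teacher \<theta> (2 * k + 1)) = cis (\<theta> k)" if "k < K" for k
      using that d_gt by (auto simp: teacher_def place_def complex_eq_iff)
    then have eq: "(\<Sum>j<d. teacher \<theta> j * fst (encode y) j) = - radius * (\<Sum>k<K. cis (\<theta> k) \<bullet> x k)"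
      unfolding Some sum_encode_Some by simp
    have "radius * (b * K / 2) = (radius * (b * sqrt K)) * sqrt K / 2" by simp
    then have "radius * (b * K / 2) = \<gamma> * (3 / 2 * sqrt K)"
      unfolding radius_b by simp
    moreover have "radius * (b * K / 2) < radius * (\<Sum>k<K. cis (\<theta> k) \<bullet> x k)"
      using corr radius_pos by (rule mult_strict_left_mono)
    ultimately show ?thesis using s unfolding eq by linarith
  qed
qed

lemma prob_algebra_example_distribution: "example_distribution \<theta> \<in> space (prob_algebra (example_space d))"
proof -
  have "prob_space (point_measure points (\<lambda>y. ennreal (mass \<theta> y)))"
    using mass_nonneg sum_mass by (intro prob_space_point_measure) (auto simp: sum_ennreal)
  then show ?thesis
    unfolding space_prob_algebra example_distribution_def
    using encode_in_space by (auto intro!: prob_space.prob_space_distr)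
qed

lemma measure_example_distribution:
  assumes "S \<in> sets (example_space d)"
  shows "measure (example_distribution \<theta>) S = (\<Sum>y\<in>{y \<in> points. encode y \<in> S}. mass \<theta> y)"
  unfolding example_distribution_def
  using assms mass_nonneg encode_in_space by (intro measure_distr_point_measure) auto

text \<open>By Cauchy-Schwarz a perturbation of length \<gamma> moves the inner product with the
  teacher by at most the amount that \<open>teacher_margin\<close> allows, so robust errors occur
  only where \<open>mass\<close> vanishes.\<close>

lemma realizable_example_distribution: "realizable d \<gamma> (example_distribution \<theta>)"
  unfolding realizable_def
proof
  let ?h = "halfspace d (teacher \<theta>)"
  show "teacher \<theta> \<in> Rd d" by (simp add: teacher_def)
  have zero: "mass \<theta> y = 0" if y: "y \<in> points" and err: "encode y \<in> robust_error d \<gamma> ?h" for y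
  proof (rule ccontr)
    assume "mass \<theta> y \<noteq> 0"
    then have pos: "mass \<theta> y > 0" using mass_nonneg[OF y, of \<theta>] by simp
    define x where "x = fst (encode y)"
    obtain z where z: "z \<in> unit_ball d" "L2_set (\<lambda>j. z j - x j) {..<d} \<le> \<gamma>" "?h z \<noteq> -1"
      using err by (auto simp: robust_error_def x_def snd_encode split: prod.splits) (metis fst_conv snd_conv snd_encode)
    have "(\<Sum>j<d. teacher \<theta> j * (z j - x j)) \<le> (\<Sum>j<d. \<bar>teacher \<theta> j\<bar> * \<bar>z j - x j\<bar>)"
      by (intro sum_mono) (simp add: abs_mult[symmetric])
    also have "\<dots> \<le> L2_set (teacher \<theta>) {..<d} * L2_set (\<lambda>j. z j - x j) {..<d}" by (rule L2_set_mult_ineq)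
    also have "\<dots> \<le> sqrt (2 * K) * \<gamma>" unfolding L2_set_teacher using z(2) by (intro mult_left_mono) auto
    finally have "(\<Sum>j<d. teacher \<theta> j * z j) < 0"
      using teacher_margin[OF y pos] by (simp add: x_def right_diff_distrib sum_subtractf mult.commute)
    then show False using z by (simp add: halfspace_def)
  qed
  then show "robust_risk d \<gamma> ?h (example_distribution \<theta>) = 0"
    unfolding robust_risk_def
  proof (cases "robust_error d \<gamma> ?h \<in> sets (example_space d)")
    case True
    then show "measure (example_distribution \<theta>) (robust_error d \<gamma> ?h) = 0"
      using zero by (subst measure_example_distribution) (auto intro!: sum.neutral)
  next
    \<comment> \<open>A set outside the sigma-algebra has \<open>measure\<close> 0 by convention, so
      the risk vanishes in this case too.\<close>
    case False
    then show "measure (example_distribution \<theta>) (robust_error d \<gamma> ?h) = 0"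
      by (intro measure_notin_sets) (simp add: example_distribution_def)
  qed
qed

section \<open>Output hypotheses as directions\<close>

definition resolution :: nat where
  "resolution = nat \<lceil>10 * d / \<gamma>\<rceil>"

definition direction :: "((nat \<Rightarrow> real) \<Rightarrow> int) \<Rightarrow> nat \<Rightarrow> complex" where
  "direction h k = Complex (normal d resolution h (2 * k)) (normal d resolution h (2 * k + 1))"

lemma resolution_ge: "10 * d / \<gamma> \<le> resolution"
  unfolding resolution_def by (rule real_nat_ceiling_ge)

lemma resolution_pos: "resolution > 0"
  using resolution_ge d_gt \<gamma>_pos by (cases resolution) (auto simp: divide_le_0_iff)

lemma direction_norm: "(\<Sum>k<K. (norm (direction h k))\<^sup>2) \<le> 1"
proof -
  have "(\<Sum>k<K. (norm (direction h k))\<^sup>2) = (\<Sum>j<2 * K. (normal d resolution h j)\<^sup>2)"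
    unfolding sum_lessThan_double by (simp add: direction_def cmod_power2)
  also have "\<dots> \<le> (\<Sum>j<d. (normal d resolution h j)\<^sup>2)"
    using d_gt by (intro sum_mono2) auto
  also have "\<dots> \<le> 1" by (rule sum_normal_square_le)
  finally show ?thesis .
qed

lemma direction_measurable:
  assumes "randomized_learner d M A"
  shows "(\<lambda>h. direction h k) \<in> borel_measurable M"
proof -
  have [measurable]: "(\<lambda>h. normal d resolution h j) \<in> borel_measurable M" for j
    using assms by (intro normal_measurable resolution_pos) (auto simp: randomized_learner_def)
  show ?thesis unfolding direction_def Complex_eq by measurable
qed

text \<open>A sign vector without robust error gives \<open>normal_margin\<close> its hypothesis,
  and \<open>encode\<close> turns the resulting margin into a correlation with that sign
  vector.\<close>

lemma direction_correlation_ge: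
  assumes h: "h \<in> halfspace d ` Rd d"
    and err: "robust_error d (0.9 * \<gamma>) h \<in> sets (example_space d)"
    and risk: "robust_risk d (0.9 * \<gamma>) h (example_distribution \<theta>) \<le> 1 / 36"
  shows "sqrt K / 10 \<le> (\<Sum>k<K. direction h k \<bullet> cis (\<theta> k))"
proof (rule correlation_of_mostly_correct[OF direction_norm, where Err = "{y. encode y \<in> robust_error d (0.9 * \<gamma>) h}"])
  show "(\<Sum>y\<in>{y \<in> points. y \<in> {y. encode y \<in> robust_error d (0.9 * \<gamma>) h}}. mass \<theta> y) \<le> 1 / 36"
    using risk unfolding robust_risk_def measure_example_distribution[OF err] by simp
next
  fix x assume x: "x \<in> cube" and ok: "Some x \<notin> {y. encode y \<in> robust_error d (0.9 * \<gamma>) h}"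
  then have y: "Some x \<in> points" by (simp add: points_def)
  have "(\<Sum>j<d. normal d resolution h j * fst (encode (Some x)) j) \<le> - (0.45 * \<gamma>)"
  proof (rule normal_margin[OF h _ resolution_ge \<gamma>_pos \<gamma>_le L2_set_encode_le[OF y]])
    show "1 \<le> d" using d_gt by simp
    fix z assume z: "z \<in> unit_ball d" "L2_set (\<lambda>j. z j - fst (encode (Some x)) j) {..<d} \<le> 0.9 * \<gamma>"
    have "(fst (encode (Some x)), -1) \<in> space (example_space d)"
      using encode_in_space y by (metis Pi_mem prod.collapse snd_encode)
    moreover have "(fst (encode (Some x)), -1) \<notin> robust_error d (0.9 * \<gamma>) h"
      using ok by (metis mem_Collect_eq prod.collapse snd_encode)
    ultimately show "h z = -1" using z unfolding robust_error_def by blast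
  qed
  then have "0.45 * \<gamma> \<le> radius * (\<Sum>k<K. direction h k \<bullet> x k)"
    by (simp add: sum_encode_Some direction_def)
  \<comment> \<open>By \<open>radius_b\<close> the product of \<open>radius\<close> and
    \<open>b * sqrt K\<close> is \<open>3 * \<gamma>\<close>, which explains the constant
    \<open>15 / 100\<close>.\<close>
  moreover have "0.45 * \<gamma> = radius * (15 / 100 * (b * sqrt K))" using radius_b by (simp add: algebra_simps)
  ultimately have "radius * (15 / 100 * (b * sqrt K)) \<le> radius * (\<Sum>k<K. direction h k \<bullet> x k)"
    by linarith
  then show "15 / 100 * (b * sqrt K) \<le> (\<Sum>k<K. direction h k \<bullet> x k)"
    using radius_pos by (rule mult_left_le_imp_le)
qed

lemma abs_direction_correlation_le: "\<bar>\<Sum>k<K. direction h k \<bullet> cis (\<theta> k)\<bar> \<le> sqrt K"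
proof -
  have "(\<Sum>k<K. direction h k \<bullet> cis (\<theta> k))\<^sup>2 \<le> (\<Sum>k<K. norm (direction h k) * 1)\<^sup>2"
  proof (rule abs_le_square_iff[THEN iffD1])
    have "\<bar>\<Sum>k<K. direction h k \<bullet> cis (\<theta> k)\<bar> \<le> (\<Sum>k<K. norm (direction h k) * 1)"
      using Cauchy_Schwarz_ineq2[of "direction h _" "cis _"] by (intro order_trans[OF sum_abs] sum_mono) auto
    then show "\<bar>\<Sum>k<K. direction h k \<bullet> cis (\<theta> k)\<bar> \<le> \<bar>\<Sum>k<K. norm (direction h k) * 1\<bar>" by linarith
  qed
  also have "\<dots> \<le> (\<Sum>k<K. (norm (direction h k))\<^sup>2) * (\<Sum>k<K. 1\<^sup>2)"
    by (rule Cauchy_Schwarz_ineq_sum)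
  also have "\<dots> \<le> 1 * real K" using direction_norm[of h] by (intro mult_mono) auto
  finally show ?thesis using real_le_rsqrt[of "\<bar>\<Sum>k<K. direction h k \<bullet> cis (\<theta> k)\<bar>"] by simp
qed

text \<open>The correlation is at least \<open>sqrt K / 10\<close> for outputs of small risk and at
  least \<open>- sqrt K\<close> always. With success probability at least \<open>35 / 36\<close>,
  its mean is at least \<open>(11 / 10 * (35 / 36) - 1) * sqrt K\<close>, hence at least
  \<open>sqrt K / 20\<close>.\<close>

theorem sample_size_ge:
  assumes learner: "robust_learner d \<gamma> (0.9 * \<gamma>) \<alpha> \<xi> n M A"
    and proper: "proper d M"
    and priv: "differentially_private \<epsilon> \<delta> d M A"
    and \<alpha>: "\<alpha> \<le> 1 / 36" and \<xi>: "\<xi> \<le> 1 / 36" and \<epsilon>: "\<epsilon> \<le> 1" and \<delta>: "\<delta> \<ge> 0"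
  shows "sqrt K / 20 \<le> n * (10 * b + \<delta> * (4 * b * sqrt K + 5 * b))"
proof (rule private_correlation_le[where N = "\<lambda>ys. A (map encode ys)" and P = M and v = direction])
  have rl: "randomized_learner d M A" using learner by (simp add: robust_learner_def)
  have dataset: "map encode ys \<in> datasets d" if "ys \<in> lists points" for ys
    using that encode_in_space by (auto simp: in_lists_conv_set)
  show prob: "prob_space (A (map encode ys))" and sets: "sets (A (map encode ys)) = sets M"
    if "ys \<in> lists points" for ys
    using rl dataset[OF that] by (auto simp: randomized_learner_def space_prob_algebra)
  show dir: "(\<lambda>h. direction h k) \<in> borel_measurable M" for k
    by (rule direction_measurable[OF rl])
  show "(\<Sum>k<K. (norm (direction h k))\<^sup>2) \<le> 1" for h by (rule direction_norm)
  show "measure (A (map encode (us @ z # vs))) S \<le> exp \<epsilon> * measure (A (map encode (us @ vs))) S + \<delta>"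
    if "us \<in> lists points" "z \<in> points" "vs \<in> lists points" "S \<in> sets M" for us z vs S
  proof -
    have "map encode (us @ z # vs) \<in> datasets d" "map encode (us @ vs) \<in> datasets d"
      using that by (auto intro!: dataset simp del: map_append)
    moreover have "neighbors (map encode (us @ z # vs)) (map encode (us @ vs))"
      unfolding neighbors_def by (intro exI[of _ "map encode us"] exI[of _ "encode z"] exI[of _ "map encode vs"]) simp
    ultimately show ?thesis using priv that(4) unfolding differentially_private_def by blast
  qed
  show "sqrt K / 20 \<le> (\<Sum>X\<in>{..<n} \<rightarrow>\<^sub>E points. (\<Prod>i<n. mass \<theta> (X i)) *
      (\<integral>h. (\<Sum>k<K. direction h k \<bullet> cis (\<theta> k)) \<partial>A (map encode (map X [0..<n]))))" for \<theta>
  proof -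
    define good where "good = {h \<in> space M. robust_risk d (0.9 * \<gamma>) h (example_distribution \<theta>) \<le> \<alpha>}"
    define weight where "weight X = (\<Prod>i<n. mass \<theta> (X i))" for X
    have good: "good \<in> sets M"
      and success: "1 - \<xi> \<le> measure (output_distribution n (example_distribution \<theta>) A) good"
      using learner realizable_example_distribution[of \<theta>] prob_algebra_example_distribution[of \<theta>]
      unfolding robust_learner_def good_def by auto
    have "measure (output_distribution n (example_distribution \<theta>) A) good =
        (\<Sum>X\<in>{..<n} \<rightarrow>\<^sub>E points. weight X * measure (A (map (\<lambda>i. encode (X i)) [0..<n])) good)"
      unfolding example_distribution_def weight_def
      using learner good mass_nonneg sum_mass encode_in_space
      by (intro output_distribution_finite_support) (auto simp: robust_learner_def)
    then have avg: "35 / 36 \<le> (\<Sum>X\<in>{..<n} \<rightarrow>\<^sub>E points. weight X * measure (A (map encode (map X [0..<n]))) good)"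
      using success \<xi> by (simp add: comp_def)
    have total: "(\<Sum>X\<in>{..<n} \<rightarrow>\<^sub>E points. weight X) = 1"
      unfolding weight_def by (subst prod_sum_PiE[symmetric]) (auto simp: sum_mass)
    have weight_nonneg: "weight X \<ge> 0" if "X \<in> {..<n} \<rightarrow>\<^sub>E points" for X
      unfolding weight_def using PiE_mem[OF that] by (intro prod_nonneg ballI mass_nonneg) auto
    have lower: "11 / 10 * sqrt K * indicator good h - sqrt K \<le> (\<Sum>k<K. direction h k \<bullet> cis (\<theta> k))"
      if "h \<in> space M" for h
    proof (cases "h \<in> good")
      case True
      have "h \<in> halfspace d ` Rd d" using proper that by (auto simp: proper_def)
      then have "sqrt K / 10 \<le> (\<Sum>k<K. direction h k \<bullet> cis (\<theta> k))"
        using True \<alpha> learner by (intro direction_correlation_ge) (auto simp: good_def robust_learner_def)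
      then show ?thesis using True by simp
    next
      case False
      then show ?thesis using abs_direction_correlation_le[of h \<theta>] by simp
    qed
    have each: "11 / 10 * sqrt K * measure (A (map encode (map X [0..<n]))) good - sqrt K \<le>
        (\<integral>h. (\<Sum>k<K. direction h k \<bullet> cis (\<theta> k)) \<partial>A (map encode (map X [0..<n])))"
      if X: "X \<in> {..<n} \<rightarrow>\<^sub>E points" for X
    proof -
      have "X i \<in> points" if "i < n" for i using PiE_mem[OF X, of i] that by simp
      then have ys: "map X [0..<n] \<in> lists points" by (auto simp: in_lists_conv_set)
      define N where "N = A (map encode (map X [0..<n]))"
      interpret prob_space N unfolding N_def by (rule prob[OF ys])
      have N: "sets N = sets M" unfolding N_def by (rule sets[OF ys])
      then have spaceN: "space N = space M" by (rule sets_eq_imp_space_eq)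
      have "(\<lambda>h. \<Sum>k<K. direction h k \<bullet> cis (\<theta> k)) \<in> borel_measurable M"
        using dir by measurable
      then have int: "integrable N (\<lambda>h. \<Sum>k<K. direction h k \<bullet> cis (\<theta> k))"
        using abs_direction_correlation_le N
        by (intro integrable_const_bound[of _ "sqrt K"]) (auto cong: measurable_cong_sets)
      have goodN: "good \<in> sets N" using good N by simp
      have "11 / 10 * sqrt K * measure N good - sqrt K = (\<integral>h. 11 / 10 * sqrt K * indicator good h - sqrt K \<partial>N)"
        using goodN by (subst Bochner_Integration.integral_diff) (auto simp: prob_space emeasure_eq_measure)
      also have "\<dots> \<le> (\<integral>h. (\<Sum>k<K. direction h k \<bullet> cis (\<theta> k)) \<partial>N)"
        using goodN int lower spaceN by (intro integral_mono) (auto simp: emeasure_eq_measure)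
      finally show ?thesis by (simp add: N_def)
    qed
    have "sqrt K / 20 \<le> 11 / 10 * sqrt K * (35 / 36) - sqrt K" by (simp add: field_simps)
    also have "\<dots> \<le> 11 / 10 * sqrt K * (\<Sum>X\<in>{..<n} \<rightarrow>\<^sub>E points. weight X * measure (A (map encode (map X [0..<n]))) good) -
        sqrt K * (\<Sum>X\<in>{..<n} \<rightarrow>\<^sub>E points. weight X)"
      using avg total by (intro diff_mono mult_left_mono) auto
    also have "\<dots> = (\<Sum>X\<in>{..<n} \<rightarrow>\<^sub>E points. weight X *
        (11 / 10 * sqrt K * measure (A (map encode (map X [0..<n]))) good - sqrt K))"
      by (simp only: right_diff_distrib sum_subtractf sum_distrib_left mult_ac)
    also have "\<dots> \<le> (\<Sum>X\<in>{..<n} \<rightarrow>\<^sub>E points. weight X *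
        (\<integral>h. (\<Sum>k<K. direction h k \<bullet> cis (\<theta> k)) \<partial>A (map encode (map X [0..<n]))))"
      by (intro sum_mono mult_left_mono each weight_nonneg)
    finally show ?thesis by (simp add: weight_def)
  qed
qed (use \<epsilon> \<delta> in auto)

end

section \<open>Choice of the parameters\<close>

text \<open>For small \<open>d\<close> the claim follows from \<open>c * d <= 1 <= n\<close>.
  Otherwise \<open>b\<close> is the least bias that the lower bounds \<open>9 * \<gamma>\<close> and
  \<open>40 / sqrt K\<close> permit, and \<open>n * b\<close> is at least of order
  \<open>sqrt K\<close>. The two cases of the maximum give the two terms of the minimum.\<close>

theorem theorem3:
  "\<exists>c0 > (0::real). \<exists>c > (0::real).
     \<forall>(d::nat) (n::nat) (\<gamma>::real) (\<alpha>::real) (\<xi>::real) (\<epsilon>::real) (\<delta>::real) M A.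
       d \<ge> 1 \<longrightarrow> n \<ge> 1 \<longrightarrow>
       \<gamma> \<in> {0<..c0} \<longrightarrow> \<alpha> \<in> {0<..c0} \<longrightarrow> \<xi> \<in> {0<..c0} \<longrightarrow>
       \<epsilon> \<in> {0<..<1} \<longrightarrow> \<delta> \<in> {0..c / real n} \<longrightarrow>
       robust_learner d \<gamma> (0.9 * \<gamma>) \<alpha> \<xi> n M A \<longrightarrow>
       proper d M \<longrightarrow>
       differentially_private \<epsilon> \<delta> d M A \<longrightarrow>
       real n \<ge> c * min (sqrt (real d) / \<gamma>) (real d)"
proof -
  define c :: real where "c = 1 / 1000000"
  have main: "c * min (sqrt (real d) / \<gamma>) (real d) \<le> real n"
    if n: "n \<ge> 1" and \<gamma>: "0 < \<gamma>" "\<gamma> \<le> 1 / 36" and \<alpha>: "\<alpha> \<le> 1 / 36" and \<xi>: "\<xi> \<le> 1 / 36"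
      and \<epsilon>: "\<epsilon> < 1" and \<delta>: "0 \<le> \<delta>" "\<delta> \<le> c / n"
      and learner: "robust_learner d \<gamma> (0.9 * \<gamma>) \<alpha> \<xi> n M A" "proper d M" "differentially_private \<epsilon> \<delta> d M A"
    for d n \<gamma> \<alpha> \<xi> \<epsilon> \<delta> M A
  proof (cases "d \<le> 60000")
    case True
    have "c * min (sqrt (real d) / \<gamma>) (real d) \<le> c * real d"
      by (intro mult_left_mono) (auto simp: c_def)
    also have "\<dots> \<le> 1" using True by (simp add: c_def)
    finally show ?thesis using n by simp
  next
    case False
    define K where "K = (d - 1) div 2"
    define b where "b = max (9 * \<gamma>) (40 / sqrt K)"
    \<comment> \<open>Since \<open>25600 = 160^2\<close>, the bias \<open>40 / sqrt K\<close> is at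
      most \<open>1 / 4\<close>.\<close>
    have K: "25600 \<le> K" "d \<le> 4 * K" "2 * K < d" using False by (auto simp: K_def)
    have "sqrt (160\<^sup>2) \<le> sqrt K" using K(1) by (intro real_sqrt_le_mono) simp
    then have sK: "160 \<le> sqrt K" by simp
    have b: "0 < b" "b \<le> 1 / 4" "9 * \<gamma> \<le> b" "40 \<le> b * sqrt K"
    proof -
      show "0 < b" "9 * \<gamma> \<le> b" using \<gamma> by (auto simp: b_def)
      have "40 / sqrt K \<le> 40 / 160" using sK K(1) by (intro divide_left_mono) auto
      then show "b \<le> 1 / 4" using \<gamma> unfolding b_def by (intro max.boundedI) auto
      have "40 / sqrt K * sqrt K \<le> b * sqrt K" by (intro mult_right_mono) (auto simp: b_def)
      then show "40 \<le> b * sqrt K" using K(1) by simp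
    qed
    interpret embedded_torus_family b K \<gamma> d
      by unfold_locales (use b \<gamma> K in auto)
    have "sqrt K / 20 \<le> n * (10 * b + \<delta> * (4 * b * sqrt K + 5 * b))"
      using learner \<alpha> \<xi> _ \<delta>(1) by (rule sample_size_ge) (use \<epsilon> in simp)
    also have "\<dots> = 10 * (n * b) + (n * \<delta>) * (b * (4 * sqrt K + 5))"
      by (simp add: algebra_simps)
    \<comment> \<open>Since \<open>n * \<delta> <= c\<close> and \<open>b <= 1 / 4\<close>, the
      privacy term is a tiny multiple of \<open>sqrt K\<close> and is absorbed on the left.\<close>
    also have "\<dots> \<le> 10 * (n * b) + c * (1 / 4 * (4 * sqrt K + 5))"
      using \<delta> b n by (intro add_left_mono mult_mono mult_right_mono) (auto simp: field_simps c_def)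
    finally have "sqrt K / 20 \<le> 10 * (n * b) + 1 / 1000000 * (1 / 4 * (4 * sqrt K + 5))" by (simp only: c_def)
    moreover have "4 / 1000 * s \<le> x"
      if "s / 20 \<le> 10 * x + 1 / 1000000 * (1 / 4 * (4 * s + 5))" "160 \<le> s" for s x :: real
      using that by (simp add: field_simps)
    ultimately have nb: "4 / 1000 * sqrt K \<le> n * b" using sK by blast
    show ?thesis
    proof (cases "b = 9 * \<gamma>")
      case True
      have "sqrt d \<le> sqrt (2\<^sup>2 * K)" using K(2) by (intro real_sqrt_le_mono) simp
      then have "sqrt d \<le> 2 * sqrt K" by (simp add: real_sqrt_mult)
      then have "c * sqrt d \<le> n * \<gamma>" using nb True sK by (simp add: c_def)
      then have "c * (sqrt d / \<gamma>) \<le> n" using \<gamma> by (simp add: field_simps)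
      moreover have "c * min (sqrt (real d) / \<gamma>) (real d) \<le> c * (sqrt d / \<gamma>)"
        by (intro mult_left_mono) (auto simp: c_def)
      ultimately show ?thesis by simp
    next
      case False
      then have "b = 40 / sqrt K" by (auto simp: b_def max_def split: if_splits)
      then have "b * sqrt K = 40" using K(1) by simp
      then have "4 / 1000 * K \<le> n * 40" using mult_right_mono[OF nb, of "sqrt K"] by (simp add: mult.assoc)
      then have "c * real d \<le> n" using K(2) by (simp add: c_def)
      moreover have "c * min (sqrt (real d) / \<gamma>) (real d) \<le> c * real d"
        by (intro mult_left_mono) (auto simp: c_def)
      ultimately show ?thesis by simp
    qed
  qed
  show ?thesis
  proof (rule exI[of _ "1 / 36"], intro conjI exI[of _ c] allI impI)
    fix d n :: nat and \<gamma> \<alpha> \<xi> \<epsilon> \<delta> :: real and M A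
    assume "n \<ge> 1" "\<gamma> \<in> {0<..1 / 36}" "\<alpha> \<in> {0<..1 / 36}" "\<xi> \<in> {0<..1 / 36}" "\<epsilon> \<in> {0<..<1}" "\<delta> \<in> {0..c / real n}"
    moreover assume "robust_learner d \<gamma> (0.9 * \<gamma>) \<alpha> \<xi> n M A" "proper d M" "differentially_private \<epsilon> \<delta> d M A"
    ultimately show "c * min (sqrt (real d) / \<gamma>) (real d) \<le> real n"
      by (intro main[of n \<gamma> \<alpha> \<xi> \<epsilon> \<delta> d M A]) auto
  qed (simp_all add: c_def)
qed

end
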